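(* Let $m\ge 0$ be an integer, let $\Omega_0\subset\mathbb{R}$ be a closed bounded interval and let $u$ be a function on $\Omega_0$. For a closed subinterval $\Omega=[a,b]\subseteq\Omega_0$ of length $h=b-a$ with $0<h\le 1$, put $\tilde u(t)=u\left(\frac{h}{2}t+\frac{a+b}{2}\right)$, $-1\le t\le 1$, and let $c_k$ and $\tilde c_k$ be the $k$-th continuous Chebyshev coefficient of $\tilde u$ and its $n$-point discrete counterpart, respectively. Then the following hold. (i) If $u\in X^m(\Omega_0)$, there is a constant $C>0$, independent of $h$ and $n$, such that for every such $\Omega$, every integer $n\ge 1$ and every integer $0\le k\le n-1$, $$|c_k-\tilde c_k|\le C\,\frac{h^{\min\{n+1,m+1\}}}{n^{m+2}}.$$ (ii) If $u\in C^{m+2}(\Omega_0)$, there is a constant $C>0$, independent of $h$ and $n$, such that for every such $\Omega$, every integer $n\ge 1$ and every integer $0\le k\le n-1$, $$|c_k-\tilde c_k|\le C\,\frac{h^{\min\{n+1,m+2\}}}{n^{m+2}}.$$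
   Context: For a closed bounded interval $I$ and an integer $m\ge 0$, $X^m(I)=C^m(I)\cap C^{m+2}_{\mathrm{pw}}(I)$: the functions that are $m$ times continuously differentiable on $I$ and have piecewise continuous $(m+2)$-th derivative, i.e. there is a finite partition of $I$ such that on each closed subinterval of the partition the function coincides in the interior with a $C^{m+2}$ function on that closed subinterval. $T_k$ is the Chebyshev polynomial of the first kind of degree $k$. With $\gamma_0=1$ and $\gamma_k=2$ for $k\ge1$, the continuous Chebyshev coefficients of $\tilde u$ are $c_k=\frac{\gamma_k}{\pi}\int_{-1}^{1}\tilde u(t)\frac{T_k(t)}{\sqrt{1-t^2}}\,dt$, and the discrete ones (for $0\le k\le n-1$) are $\tilde c_k=\frac{\gamma_k}{n}\sum_{i=0}^{n-1}\tilde u(t_i)T_k(t_i)$, where $t_i=\cos\left(\pi\frac{2i+1}{2n}\right)$; here $n$ is the number of terms in the discrete expansion $\tilde u(t)\approx\sum_{k=0}^{n-1}\tilde c_kT_k(t)$. *)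

theory Defs
  imports "HOL-Analysis.Analysis" "HOL-Computational_Algebra.Polynomial"
begin

text \<open>
  Membership in \<open>C\<^sup>k(S)\<close>: \<open>D j\<close> is the \<open>j\<close>-th derivative of \<open>f\<close> on \<open>S\<close>. Derivatives are taken
  within \<open>S\<close>, hence one-sided at the endpoints of an interval; values outside \<open>S\<close> are irrelevant.
\<close>

definition Ck_on :: "nat \<Rightarrow> (real \<Rightarrow> real) \<Rightarrow> real set \<Rightarrow> bool" where
  "Ck_on k f S \<longleftrightarrow>
     (\<exists>D :: nat \<Rightarrow> real \<Rightarrow> real.
        (\<forall>x\<in>S. D 0 x = f x) \<and>
        (\<forall>j<k. \<forall>x\<in>S. (D j has_real_derivative D (Suc j) x) (at x within S)) \<and>
        continuous_on S (D k))"

text \<open>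
  Membership in \<open>C\<^sup>k\<^sub>p\<^sub>w(I)\<close> for a compact interval \<open>I\<close>. The library notion \<open>division_of\<close> also admits
  one-point pieces; these have empty interior and impose no condition.
\<close>

definition piecewise_Ck_on :: "nat \<Rightarrow> (real \<Rightarrow> real) \<Rightarrow> real set \<Rightarrow> bool" where
  "piecewise_Ck_on k f I \<longleftrightarrow>
     (\<exists>P. P division_of I \<and>
        (\<forall>K\<in>P. \<exists>g. Ck_on k g K \<and> (\<forall>x\<in>interior K. f x = g x)))"

definition X_space :: "nat \<Rightarrow> real set \<Rightarrow> (real \<Rightarrow> real) set" where
  "X_space m I = {f. Ck_on m f I \<and> piecewise_Ck_on (m + 2) f I}"

fun cheb_poly :: "nat \<Rightarrow> real poly" where
  "cheb_poly 0 = 1"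
| "cheb_poly (Suc 0) = [:0, 1:]"
| "cheb_poly (Suc (Suc k)) = [:0, 2:] * cheb_poly (Suc k) - cheb_poly k"

definition cheb_gamma :: "nat \<Rightarrow> real" where
  "cheb_gamma k = (if k = 0 then 1 else 2)"

definition cheb_node :: "nat \<Rightarrow> nat \<Rightarrow> real" where
  "cheb_node n i = cos (pi * ((2 * real i + 1) / (2 * real n)))"

text \<open>
  At \<open>t = -1\<close> and \<open>t = 1\<close> the integrand below takes the value \<open>0\<close> (division by zero), which
  does not affect the integral.
\<close>

definition cheb_coeff :: "(real \<Rightarrow> real) \<Rightarrow> nat \<Rightarrow> real" where
  "cheb_coeff v k =
     cheb_gamma k / pi * integral {-1..1} (\<lambda>t. v t * (poly (cheb_poly k) t / sqrt (1 - t\<^sup>2)))"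

definition disc_cheb_coeff :: "nat \<Rightarrow> (real \<Rightarrow> real) \<Rightarrow> nat \<Rightarrow> real" where
  "disc_cheb_coeff n v k =
     cheb_gamma k / real n * (\<Sum>i=0..<n. v (cheb_node n i) * poly (cheb_poly k) (cheb_node n i))"

definition pullback :: "(real \<Rightarrow> real) \<Rightarrow> real \<Rightarrow> real \<Rightarrow> real \<Rightarrow> real" where
  "pullback u a b t = u ((b - a) / 2 * t + (a + b) / 2)"

end

theory Submission
  imports Defs
begin

text \<open>
  Both coefficients are studied through the substitution \<open>t = cos x\<close>, which turns the Chebyshev
  expansion into a cosine series on \<open>{0..pi}\<close> and the nodes into equidistant angles.

  At the nodes, \<open>cos (l x)\<close> is orthogonal to \<open>cos (k x)\<close> unless \<open>2 n\<close> divides \<open>l - k\<close> or \<open>l + k\<close>.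
  If the cosine series converges absolutely, the error in the \<open>k\<close>-th coefficient is therefore a
  weighted sum, with bounded weights, of coefficients with index \<open>2 n j - k\<close> or \<open>2 n j + k\<close>, where \<open>j \<ge> 1\<close>. All of these indices
  exceed \<open>n\<close>. If the coefficients beyond \<open>n\<close> are bounded by \<open>B / l ^ (m + 2)\<close>, then the error is at
  most a constant times \<open>B / n ^ (m + 2)\<close> (lemma \<open>aliasing_error_le\<close>).

  The decay \<open>B / l ^ (m + 2)\<close> comes from \<open>m + 1\<close> integrations by parts, followed by the second mean
  value theorem, which exploits that the derivative of order \<open>m + 1\<close> is a difference of monotone
  functions (lemma \<open>moment_decay\<close>). Bounded variation is the common feature of the two classes of
  functions: a piecewise \<open>C\<^sup>1\<close> function has it, jumps included, and so has a \<open>C\<^sup>1\<close> function.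

  The power of \<open>h\<close> in \<open>B\<close> is not automatic, since the chain rule produces all derivatives of the
  pullback, including the first, which is only of order \<open>h\<close>. However, coefficients beyond \<open>n\<close> do not
  see polynomials of degree at most \<open>n\<close>. So a Taylor polynomial of degree \<open>e - 1 \<le> n\<close> may be
  subtracted, after which every derivative of the pullback is of order \<open>h ^ e\<close>
  (lemmas \<open>taylor_remainder_bounds\<close> and \<open>coefficient_error_le\<close>). In the piecewise case \<open>e\<close> cannot
  exceed \<open>m + 1\<close>, because the derivative of order \<open>m + 1\<close> has jumps of fixed size; in the smooth
  case \<open>e = m + 2\<close> is possible. Together with \<open>e \<le> n + 1\<close> this gives the two minima.
\<close>

section \<open>Chebyshev coefficients as cosine coefficients\<close>

lemma poly_cheb_poly_cos: "poly (cheb_poly k) (cos x) = cos (real k * x)"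
proof (induction k rule: cheb_poly.induct)
  case (3 k)
  have "cos (real (Suc (Suc k)) * x) + cos (real k * x) = 2 * cos x * cos (real (Suc k) * x)"
    using cos_plus_cos[of "real (Suc (Suc k)) * x" "real k * x"] 
    by (simp add: algebra_simps add_divide_distrib)
  with 3 show ?case by (simp add: algebra_simps)
qed auto

definition cos_coeff :: "(real \<Rightarrow> real) \<Rightarrow> nat \<Rightarrow> real" where
  "cos_coeff f l = cheb_gamma l / pi * integral {0..pi} (\<lambda>x. f x * cos (real l * x))"

text \<open>
  This is the substitution \<open>t = cos x\<close>. The weight \<open>1 / sqrt (1 - t\<^sup>2)\<close> is unbounded, so instead of
  a change of variables the proof exhibits an antiderivative that is continuous up to the
  endpoints: \<open>- G (arccos t)\<close>, where \<open>G\<close> is an antiderivative of the transformed integrand.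
\<close>

lemma cheb_coeff_eq_cos_coeff:
  assumes v: "continuous_on {-1..1} v"
  shows "cheb_coeff v k = cos_coeff (\<lambda>x. v (cos x)) k"
proof -
  define f where "f = (\<lambda>x. v (cos x) * cos (real k * x))"
  define G where "G = (\<lambda>x. integral {0..x} f)"
  have vc: "continuous_on {0..pi} (\<lambda>x. v (cos x))"
    by (rule continuous_on_compose2[OF v]) (auto intro!: continuous_intros)
  have f: "continuous_on {0..pi} f"
    unfolding f_def by (intro continuous_intros vc)
  have G: "(G has_real_derivative f x) (at x within {0..pi})" if "x \<in> {0..pi}" for x
    unfolding G_def using integral_has_real_derivative[OF f that] .
  have Gc: "continuous_on {0..pi} G"
    using DERIV_continuous_on[OF G] .
  have "((\<lambda>t. v t * (poly (cheb_poly k) t / sqrt (1 - t\<^sup>2))) has_integral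
      (- G (arccos 1)) - (- G (arccos (- 1)))) {-1..1}"
  proof (rule fundamental_theorem_of_calculus_interior)
    show "continuous_on {-1..1} (\<lambda>t. - G (arccos t))"
      by (intro continuous_on_minus continuous_on_compose2[OF Gc] continuous_on_arccos'
          image_subsetI) (simp add: arccos_lbound arccos_ubound)
    show "((\<lambda>t. - G (arccos t)) has_vector_derivative
        v t * (poly (cheb_poly k) t / sqrt (1 - t\<^sup>2))) (at t)" if t: "t \<in> {-1<..<1}" for t
    proof -
      have ar: "arccos t \<in> {0<..<pi}"
        using t arccos_lt_bounded[of t] by auto
      have "(G has_real_derivative f (arccos t)) (at (arccos t))"
        using G[of "arccos t"] ar at_within_Icc_at[of 0 "arccos t" pi] by simp
      moreover have "(arccos has_real_derivative inverse (- sqrt (1 - t\<^sup>2))) (at t)"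
        using t by (intro DERIV_arccos) auto
      ultimately have "((\<lambda>t. G (arccos t)) has_real_derivative
          f (arccos t) * inverse (- sqrt (1 - t\<^sup>2))) (at t)"
        by (rule DERIV_chain2)
      from DERIV_minus[OF this] show ?thesis
        unfolding has_real_derivative_iff_has_vector_derivative[symmetric] f_def
        using t poly_cheb_poly_cos[of k "arccos t"] by (simp add: field_simps)
    qed
  qed simp
  then have "integral {-1..1} (\<lambda>t. v t * (poly (cheb_poly k) t / sqrt (1 - t\<^sup>2))) = G pi - G 0"
    by (simp add: integral_unique)
  then show ?thesis
    by (simp add: cheb_coeff_def cos_coeff_def G_def f_def)
qed

lemma integral_cos_multiple:
  "integral {0..pi} (\<lambda>x. cos (real_of_int j * x)) = (if j = 0 then pi else 0)"
proof (cases "j = 0")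
  case False
  have "((\<lambda>x. cos (real_of_int j * x)) has_integral
      sin (real_of_int j * pi) / j - sin (real_of_int j * 0) / j) {0..pi}"
    using False
    by (intro fundamental_theorem_of_calculus)
      (auto intro!: derivative_eq_intros
        simp: has_real_derivative_iff_has_vector_derivative[symmetric])
  moreover have "sin (real_of_int j * pi) = 0"
    by (metis mult.commute sin_npi_int)
  ultimately show ?thesis using False by (simp add: integral_unique)
qed simp

lemma cos_times_cos_nat:
  "cos (real l * x) * cos (real k * x)
     = (cos (real_of_int (int l - int k) * x) + cos (real_of_int (int l + int k) * x)) / 2"
  using cos_times_cos[of "real l * x" "real k * x"] by (simp add: left_diff_distrib distrib_right)

lemma cos_times_cos_multiple:
  assumes "0 < l"
  shows "cos x * cos (real l * x) = (cos (real (l - 1) * x) + cos (real (l + 1) * x)) / 2"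
  using cos_times_cos_nat[of l x 1] assms by (simp add: of_nat_diff add.commute mult.commute)

lemma integral_cos_cos:
  "integral {0..pi} (\<lambda>x. cos (real l * x) * cos (real k * x))
     = (if l = k then pi / cheb_gamma k else 0)"
proof -
  have "integral {0..pi} (\<lambda>x. cos (real l * x) * cos (real k * x))
      = (integral {0..pi} (\<lambda>x. cos (real_of_int (int l - int k) * x))
        + integral {0..pi} (\<lambda>x. cos (real_of_int (int l + int k) * x))) / 2"
    unfolding cos_times_cos_nat
    by (simp add: integral_add integrable_continuous_real continuous_intros
      del: of_int_diff of_int_add)
  then show ?thesis
    unfolding integral_cos_multiple by (auto simp: cheb_gamma_def)
qed

lemma integral_cos_power_eq_0:
  "i < l \<Longrightarrow> integral {0..pi} (\<lambda>x. cos x ^ i * cos (real l * x)) = 0"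
proof (induction i arbitrary: l)
  case 0
  then show ?case using integral_cos_multiple[of "int l"] by simp
next
  case (Suc i)
  have *: "cos x ^ Suc i * cos (real l * x)
      = (cos x ^ i * cos (real (l - 1) * x) + cos x ^ i * cos (real (l + 1) * x)) / 2" for x
  proof -
    have "cos x ^ Suc i * cos (real l * x) = cos x ^ i * (cos x * cos (real l * x))"
      by simp
    then show ?thesis
      using Suc.prems by (simp only: cos_times_cos_multiple) (simp add: distrib_left)
  qed
  show ?case
    unfolding * using Suc.IH[of "l - 1"] Suc.IH[of "l + 1"] Suc.prems
    by (simp add: integral_add integrable_continuous_real continuous_intros
      del: of_nat_add of_nat_diff)
qed

text \<open>
  The reason why subtracting a polynomial of degree at most \<open>n\<close> changes no coefficient beyond the
  \<open>n\<close>-th.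
\<close>

lemma integral_poly_cos_eq_0:
  assumes "degree p < l"
  shows "integral {0..pi} (\<lambda>x. poly p (cos x) * cos (real l * x)) = 0"
proof -
  have "integral {0..pi} (\<lambda>x. poly p (cos x) * cos (real l * x))
      = integral {0..pi} (\<lambda>x. \<Sum>i\<le>degree p. coeff p i * (cos x ^ i * cos (real l * x)))"
    by (simp add: poly_altdef sum_distrib_right mult.assoc)
  also have "\<dots> = (\<Sum>i\<le>degree p. coeff p i * integral {0..pi} (\<lambda>x. cos x ^ i * cos (real l * x)))"
    by (subst integral_sum) (auto intro!: integrable_continuous_real continuous_intros)
  also have "\<dots> = 0"
    using assms by (intro sum.neutral) (simp add: integral_cos_power_eq_0)
  finally show ?thesis .
qed

text \<open>
  Completeness of the cosine system. As \<open>cos x * cos (l x)\<close> is a combination of neighbouring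
  multiples, \<open>f\<close> is orthogonal to every polynomial in \<open>cos x\<close>. By Weierstrass such polynomials
  approximate \<open>f\<close> uniformly, so the integral of \<open>f\<^sup>2\<close> is arbitrarily small.
\<close>

lemma zero_if_cosine_moments_zero:
  assumes f: "continuous_on {0..pi} f"
    and zero: "\<And>l. integral {0..pi} (\<lambda>x. f x * cos (real l * x)) = 0"
    and x: "x \<in> {0..pi}"
  shows "f x = 0"
proof -
  have mom: "integral {0..pi} (\<lambda>x. f x * (cos x ^ i * cos (real l * x))) = 0" for i l
  proof (induction i arbitrary: l)
    case 0
    then show ?case using zero by simp
  next
    case (Suc i)
    show ?case
    proof (cases "l = 0")
      case True
      then show ?thesis using Suc.IH[of 1] by (simp add: mult_ac)
    next
      case False
      have *: "f x * (cos x ^ Suc i * cos (real l * x))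
          = (f x * (cos x ^ i * cos (real (l - 1) * x))
            + f x * (cos x ^ i * cos (real (l + 1) * x))) / 2" for x
      proof -
        have "f x * (cos x ^ Suc i * cos (real l * x)) = f x * (cos x ^ i * (cos x * cos (real l * x)))"
          by simp
        then show ?thesis
          using False by (simp only: cos_times_cos_multiple) (simp add: distrib_left)
      qed
      show ?thesis
        unfolding * using Suc.IH[of "l - 1"] Suc.IH[of "l + 1"]
        by (simp add: integral_add integrable_continuous_real continuous_intros f
            del: of_nat_add of_nat_diff)
    qed
  qed
  have pmom: "integral {0..pi} (\<lambda>x. f x * (\<Sum>i\<le>N. a i * cos x ^ i)) = 0" for a N
  proof -
    have "integral {0..pi} (\<lambda>x. f x * (\<Sum>i\<le>N. a i * cos x ^ i))
      = integral {0..pi} (\<lambda>x. \<Sum>i\<le>N. a i * (f x * cos x ^ i))"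
      by (simp add: sum_distrib_left mult_ac)
    also have "\<dots> = (\<Sum>i\<le>N. a i * integral {0..pi} (\<lambda>x. f x * cos x ^ i))"
      by (subst integral_sum) (auto intro!: integrable_continuous_real continuous_intros f)
    also have "\<dots> = 0"
      using mom[of _ 0] by simp
    finally show ?thesis .
  qed
  have "compact (f ` {0..pi})"
    by (intro compact_continuous_image f compact_Icc)
  then obtain M where M: "\<And>x. x \<in> {0..pi} \<Longrightarrow> \<bar>f x\<bar> \<le> M"
    by (metis bounded_real compact_imp_bounded imageI)
  have "0 \<le> M" using M[of 0] by force
  have c: "continuous_on {-1..1} (\<lambda>t. f (arccos t))"
    by (intro continuous_on_compose2[OF f] continuous_on_arccos' image_subsetI)
      (simp add: arccos_lbound arccos_ubound)
  have le: "integral {0..pi} (\<lambda>x. f x * f x) \<le> e * (M * pi)" if "e > 0" for e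
  proof -
    obtain g where g: "real_polynomial_function g"
      and ge: "\<And>t. t \<in> {-1..1} \<Longrightarrow> \<bar>f (arccos t) - g t\<bar> < e"
      using Stone_Weierstrass_real_polynomial_function[OF compact_Icc c \<open>e > 0\<close>] by metis
    obtain a N where gs: "g = (\<lambda>x. \<Sum>i\<le>N. a i * x ^ i)"
      using g real_polynomial_function_iff_sum by metis
    have gx: "\<bar>f x - g (cos x)\<bar> \<le> e" if "x \<in> {0..pi}" for x
      using ge[of "cos x"] that by (simp add: arccos_cos)
    have "integral {0..pi} (\<lambda>x. f x * f x)
      = integral {0..pi} (\<lambda>x. f x * f x - f x * g (cos x))"
      using pmom[of a N] unfolding gs
      by (subst integral_diff) (auto intro!: integrable_continuous_real continuous_intros f)
    also have "\<dots> \<le> integral {0..pi} (\<lambda>x. M * e)"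
    proof (rule integral_le)
      show "f x * f x - f x * g (cos x) \<le> M * e" if "x \<in> {0..pi}" for x
      proof -
        have "f x * f x - f x * g (cos x) \<le> \<bar>f x\<bar> * \<bar>f x - g (cos x)\<bar>"
          by (metis abs_ge_self abs_mult right_diff_distrib)
        also have "\<dots> \<le> M * e"
          using M[OF that] gx[OF that] \<open>0 \<le> M\<close> by (intro mult_mono) auto
        finally show ?thesis .
      qed
    qed (auto intro!: integrable_continuous_real continuous_intros f simp: gs)
    finally show ?thesis by (simp add: mult_ac)
  qed
  have "integral {0..pi} (\<lambda>x. f x * f x) \<le> 0"
  proof (rule ccontr)
    assume *: "\<not> ?thesis"
    define I where "I = integral {0..pi} (\<lambda>x. f x * f x)"
    have I: "0 < I" and D: "0 < M * pi + 1"
      using * \<open>0 \<le> M\<close> by (auto simp: I_def intro!: add_nonneg_pos)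
    \<comment> \<open>The value of \<open>e\<close> is chosen such that \<open>e * (M * pi)\<close> is at most half of \<open>I\<close>.\<close>
    have "I \<le> I / (2 * (M * pi + 1)) * (M * pi)"
      unfolding I_def[symmetric] using le[of "I / (2 * (M * pi + 1))"] I D I_def by simp
    also have "\<dots> = I / 2 * (M * pi / (M * pi + 1))"
      by simp
    also have "\<dots> \<le> I / 2"
      using I D \<open>0 \<le> M\<close> by (intro mult_left_le) auto
    finally show False using I by simp
  qed
  moreover have "integral {0..pi} (\<lambda>x. f x * f x) \<ge> 0"
    by (intro integral_nonneg integrable_continuous_real continuous_intros f) auto
  ultimately have "integral {0..pi} (\<lambda>x. f x * f x) = 0" by simp
  then have "f x * f x = 0"
    using x by (subst (asm) integral_eq_0_iff) (auto intro!: continuous_intros f)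
  then show ?thesis by simp
qed

text \<open>
  The sum \<open>s\<close> of the series is continuous, being a uniform limit, and integrating term by term
  shows that it has the same cosine coefficients as \<open>f\<close>. Completeness gives \<open>s = f\<close>.
\<close>

lemma cosine_series_sums:
  assumes f: "continuous_on {0..pi} f"
    and summ: "summable (\<lambda>l. \<bar>cos_coeff f l\<bar>)"
    and x: "x \<in> {0..pi}"
  shows "(\<lambda>l. cos_coeff f l * cos (real l * x)) sums f x"
proof -
  define s where "s = (\<lambda>x. \<Sum>l. cos_coeff f l * cos (real l * x))"
  have bd: "norm (cos_coeff f l * cos (real l * x)) \<le> \<bar>cos_coeff f l\<bar>" for l x
    by (simp add: abs_mult mult_left_le)
  have ul: "uniform_limit {0..pi} (\<lambda>n x. \<Sum>l<n. cos_coeff f l * cos (real l * x)) s sequentially"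
    unfolding s_def by (rule Weierstrass_m_test[OF bd summ])
  have s: "continuous_on {0..pi} s"
    by (rule uniform_limit_theorem[OF _ ul])
      (auto intro!: always_eventually continuous_intros)
  have scoeff: "integral {0..pi} (\<lambda>x. s x * cos (real k * x))
      = integral {0..pi} (\<lambda>x. f x * cos (real k * x))" for k
  proof -
    have "uniform_limit {0..pi} (\<lambda>n x. (\<Sum>l<n. cos_coeff f l * cos (real l * x)) * cos (real k * x))
        (\<lambda>x. s x * cos (real k * x)) sequentially"
    proof (rule uniform_lim_mult[OF ul uniform_limit_const])
      show "bounded (s ` {0..pi})"
        by (intro compact_imp_bounded compact_continuous_image s compact_Icc)
      show "bounded ((\<lambda>x. cos (real k * x)) ` {0..pi})"
        by (intro compact_imp_bounded compact_continuous_image continuous_intros compact_Icc)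
    qed
    then obtain I J where
      I: "\<And>n. ((\<lambda>x. (\<Sum>l<n. cos_coeff f l * cos (real l * x)) * cos (real k * x)) has_integral I n) {0..pi}"
      and J: "((\<lambda>x. s x * cos (real k * x)) has_integral J) {0..pi}" and IJ: "I \<longlonglongrightarrow> J"
      by (rule uniform_limit_integral) (auto intro!: continuous_intros)
    have "I n = pi / cheb_gamma k * cos_coeff f k" if "n > k" for n
    proof -
      have "I n = integral {0..pi} (\<lambda>x. \<Sum>l<n. cos_coeff f l * (cos (real l * x) * cos (real k * x)))"
        using integral_unique[OF I[of n]] by (simp add: sum_distrib_right mult.assoc)
      also have "\<dots> = (\<Sum>l<n. cos_coeff f l * integral {0..pi} (\<lambda>x. cos (real l * x) * cos (real k * x)))"
        by (subst integral_sum) (auto intro!: integrable_continuous_real continuous_intros)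
      also have "\<dots> = (\<Sum>l<n. if l = k then pi / cheb_gamma k * cos_coeff f k else 0)"
        by (intro sum.cong refl) (simp add: integral_cos_cos)
      also have "\<dots> = pi / cheb_gamma k * cos_coeff f k"
        using that by simp
      finally show ?thesis .
    qed
    then have "I \<longlonglongrightarrow> pi / cheb_gamma k * cos_coeff f k"
      by (intro tendsto_eventually eventually_sequentiallyI[of "Suc k"]) auto
    with IJ have "J = pi / cheb_gamma k * cos_coeff f k"
      by (rule LIMSEQ_unique)
    with J show ?thesis
      by (simp add: integral_unique cos_coeff_def cheb_gamma_def)
  qed
  have "f x - s x = 0"
  proof (rule zero_if_cosine_moments_zero[OF _ _ x])
    show "continuous_on {0..pi} (\<lambda>x. f x - s x)"
      by (intro continuous_intros f s)
    show "integral {0..pi} (\<lambda>x. (f x - s x) * cos (real l * x)) = 0" for l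
      unfolding left_diff_distrib
      by (subst integral_diff)
        (auto intro!: integrable_continuous_real continuous_intros f s simp: scoeff)
  qed
  moreover have "(\<lambda>l. cos_coeff f l * cos (real l * x)) sums s x"
    unfolding s_def by (intro summable_sums summable_comparison_test'[OF summ] bd)
  ultimately show ?thesis by simp
qed

section \<open>Aliasing at the Chebyshev nodes\<close>

definition node_angle :: "nat \<Rightarrow> nat \<Rightarrow> real" where
  "node_angle n i = pi * ((2 * real i + 1) / (2 * real n))"

lemma cheb_node_eq_cos: "cheb_node n i = cos (node_angle n i)"
  by (simp add: cheb_node_def node_angle_def)

lemma node_angle_bounds:
  assumes "i < n"
  shows "node_angle n i \<in> {0..pi}"
proof -
  have "(2 * real i + 1) / (2 * real n) \<le> 1"
    using assms by (simp add: field_simps)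
  then have "pi * ((2 * real i + 1) / (2 * real n)) \<le> pi"
    by (intro mult_left_le) auto
  then show ?thesis by (simp add: node_angle_def)
qed

text \<open>
  The angles are the odd multiples of \<open>pi / (2 n)\<close>; multiplication by \<open>2 sin (r pi / (2 n))\<close> makes
  the sum telescope to \<open>sin (r pi) = 0\<close>. The factor itself vanishes only if \<open>2 n\<close> divides \<open>r\<close>.
\<close>

lemma sum_cos_nodes_eq_0:
  assumes n: "1 \<le> n" and r: "\<not> int (2 * n) dvd r"
  shows "(\<Sum>i<n. cos (real_of_int r * node_angle n i)) = 0"
proof -
  define x where "x = real_of_int r * pi / (2 * real n)"
  have angle: "real_of_int r * node_angle n i = real (2 * i + 1) * x" for i
    using n by (simp add: node_angle_def x_def field_simps)
  have "2 * sin x * (\<Sum>i<n. cos (real_of_int r * node_angle n i))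
      = (\<Sum>i<n. sin (real (2 * Suc i) * x) - sin (real (2 * i) * x))"
    unfolding sum_distrib_left
  proof (rule sum.cong[OF refl])
    fix i
    show "2 * sin x * cos (real_of_int r * node_angle n i) = sin (real (2 * Suc i) * x) - sin (real (2 * i) * x)"
      unfolding angle using sin_diff_sin[of "real (2 * Suc i) * x" "real (2 * i) * x"]
      by (simp add: algebra_simps add_divide_distrib)
  qed
  also have "\<dots> = sin (real (2 * n) * x)"
    using sum_lessThan_telescope[of "\<lambda>i. sin (real (2 * i) * x)" n] by simp
  also have "real (2 * n) * x = real_of_int r * pi"
    using n by (simp add: x_def)
  finally have "sin x * (\<Sum>i<n. cos (real_of_int r * node_angle n i)) = 0"
    by (simp add: mult.commute[of "real_of_int r"] sin_npi_int)
  moreover have "sin x \<noteq> 0"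
  proof
    assume "sin x = 0"
    then obtain i where "x = real_of_int i * pi"
      unfolding sin_zero_iff_int2 by blast
    then have "real_of_int r = real_of_int (int (2 * n) * i)"
      using n by (simp add: x_def field_simps)
    with r show False by (metis dvd_triv_left of_int_eq_iff)
  qed
  ultimately show ?thesis by simp
qed

text \<open>
  Up to the factor \<open>cheb_gamma k\<close>, the contribution of the mode \<open>cos (l x)\<close> to the \<open>k\<close>-th discrete
  coefficient.
\<close>

definition alias_weight :: "nat \<Rightarrow> nat \<Rightarrow> nat \<Rightarrow> real" where
  "alias_weight n k l = (\<Sum>i<n. cos (real l * node_angle n i) * cos (real k * node_angle n i)) / real n"

lemma alias_weight_le_1: "\<bar>alias_weight n k l\<bar> \<le> 1"
proof -
  have "\<bar>\<Sum>i<n. cos (real l * node_angle n i) * cos (real k * node_angle n i)\<bar> \<le> (\<Sum>i<n. 1)"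
    by (intro sum_abs[THEN order_trans] sum_mono) (simp add: abs_mult mult_le_one)
  then show ?thesis
    by (cases "n = 0") (auto simp: alias_weight_def field_simps)
qed

lemma alias_weight_eq_sums:
  "alias_weight n k l = ((\<Sum>i<n. cos (real_of_int (int l - int k) * node_angle n i))
     + (\<Sum>i<n. cos (real_of_int (int l + int k) * node_angle n i))) / (2 * real n)"
  unfolding alias_weight_def cos_times_cos_nat sum_divide_distrib[symmetric] sum.distrib
  by simp

lemma alias_weight_eq_0:
  assumes "1 \<le> n" "\<not> int (2 * n) dvd int l - int k" "\<not> int (2 * n) dvd int l + int k"
  shows "alias_weight n k l = 0"
  unfolding alias_weight_eq_sums
    sum_cos_nodes_eq_0[OF assms(1,2)] sum_cos_nodes_eq_0[OF assms(1,3)] by simp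

text \<open>
  Discrete orthogonality reaches up to \<open>l = n\<close>, one step beyond the range of \<open>k\<close>, because
  \<open>l + k \<le> 2 n - 1\<close>. This is what allows the exponent \<open>n + 1\<close> of \<open>h\<close> in the theorem.
\<close>

lemma alias_weight_low:
  assumes k: "k < n" and l: "l \<le> n"
  shows "cheb_gamma k * alias_weight n k l = (if l = k then 1 else 0)"
proof -
  have small: "\<not> int (2 * n) dvd j" if "j \<noteq> 0" "\<bar>j\<bar> < int (2 * n)" for j
    using that by (metis abs_dvd_iff abs_of_nat dvd_abs_iff zdvd_not_zless zero_less_abs_iff)
  show ?thesis
  proof (cases "l = k")
    case False
    then have "alias_weight n k l = 0"
      using k l by (intro alias_weight_eq_0 small) auto
    with False show ?thesis by simp
  next
    case True
    show ?thesis
    proof (cases "k = 0")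
      case True
      with \<open>l = k\<close> k show ?thesis by (simp add: alias_weight_def cheb_gamma_def)
    next
      case False
      have "(\<Sum>i<n. cos (real_of_int (int l + int k) * node_angle n i)) = 0"
        using k l False by (intro sum_cos_nodes_eq_0 small) (auto simp: True)
      then show ?thesis
        unfolding alias_weight_eq_sums using True False k by (simp add: cheb_gamma_def)
    qed
  qed
qed

lemma sum_inverse_squares_le: "(\<Sum>j=1..N. 1 / real j ^ 2) \<le> 2"
proof -
  have "(\<Sum>j=1..N. 1 / real j ^ 2) \<le> 2 - 1 / real N" if "1 \<le> N"
    using that
  proof (induction N rule: dec_induct)
    case (step N)
    have "1 / real (Suc N) ^ 2 \<le> 1 / real N - 1 / real (Suc N)"
    proof -
      have "1 / real (Suc N) ^ 2 \<le> 1 / (real N * real (Suc N))"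
        using step(1) by (intro divide_left_mono) (auto simp: power2_eq_square)
      also have "\<dots> = 1 / real N - 1 / real (Suc N)"
        using step(1) by (simp add: field_simps)
      finally show ?thesis .
    qed
    with step show ?case by simp
  qed simp
  then show ?thesis
    by (cases "N = 0") (auto intro: order_trans)
qed

text \<open>
  The frequencies beyond \<open>n\<close> that are indistinguishable from \<open>k\<close> at the nodes are \<open>2 n j - k\<close> and
  \<open>2 n j + k\<close> with \<open>j \<ge> 1\<close>. They are at least \<open>n j\<close>, so the sum is at most a constant times
  \<open>1 / n ^ p\<close>, with no loss of a power of \<open>n\<close>.
\<close>

lemma sum_alias_frequencies_le:
  assumes k: "k < n" and p: "2 \<le> p"
  shows "(\<Sum>l | n < l \<and> l < N \<and> alias_weight n k l \<noteq> 0. 1 / real l ^ p) \<le> 4 / real n ^ p"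
proof -
  define lo where "lo = (\<lambda>j. 2 * n * j - k)"
  define hi where "hi = (\<lambda>j. 2 * n * j + k)"
  have bound: "1 / real l ^ p \<le> 1 / real n ^ p * (1 / real j ^ 2)"
    if "n * j \<le> l" "1 \<le> j" for l j
  proof -
    have "real n ^ p * real j ^ 2 \<le> real n ^ p * real j ^ p"
      using p that by (intro mult_left_mono power_increasing) auto
    also have "\<dots> \<le> real l ^ p"
      using that(1) by (metis of_nat_0_le_iff of_nat_le_iff of_nat_mult power_mono power_mult_distrib)
    finally have "real n ^ p * real j ^ 2 \<le> real l ^ p" .
    moreover have "0 < n * j" using that k by simp
    then have "0 < l" using that(1) by linarith
    ultimately have "1 / real l ^ p \<le> 1 / (real n ^ p * real j ^ 2)"
      using that k by (intro divide_left_mono) auto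
    then show ?thesis by simp
  qed
  have part: "(\<Sum>l\<in>f ` {1..N}. 1 / real l ^ p) \<le> 2 / real n ^ p"
    if f: "\<And>j. 1 \<le> j \<Longrightarrow> n * j \<le> f j" for f :: "nat \<Rightarrow> nat"
  proof -
    have "(\<Sum>l\<in>f ` {1..N}. 1 / real l ^ p) \<le> (\<Sum>j=1..N. 1 / real (f j) ^ p)"
      using sum_image_le[of "{1..N}" "\<lambda>l. 1 / real l ^ p" f] by (simp add: comp_def)
    also have "\<dots> \<le> (\<Sum>j=1..N. 1 / real n ^ p * (1 / real j ^ 2))"
      using f by (intro sum_mono bound) auto
    also have "\<dots> = 1 / real n ^ p * (\<Sum>j=1..N. 1 / real j ^ 2)"
      by (simp add: sum_distrib_left)
    also have "\<dots> \<le> 1 / real n ^ p * 2"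
      by (intro mult_left_mono sum_inverse_squares_le) auto
    finally show ?thesis by simp
  qed
  have sub: "{l. n < l \<and> l < N \<and> alias_weight n k l \<noteq> 0} \<subseteq> lo ` {1..N} \<union> hi ` {1..N}"
  proof
    fix l assume "l \<in> {l. n < l \<and> l < N \<and> alias_weight n k l \<noteq> 0}"
    then have l: "n < l" "l < N" "alias_weight n k l \<noteq> 0" by auto
    then have "int (2 * n) dvd int l - int k \<or> int (2 * n) dvd int l + int k"
      using alias_weight_eq_0[of n l k] k by auto
    then show "l \<in> lo ` {1..N} \<union> hi ` {1..N}"
    proof
      assume "int (2 * n) dvd int l - int k"
      then have "2 * n dvd l - k"
        using k l by (metis int_dvd_int_iff less_imp_le_nat of_nat_diff order_less_trans)
      then obtain j where j: "l - k = 2 * n * j" by (elim dvdE)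
      have "l = hi j" using j k l by (simp add: hi_def)
      moreover have "1 \<le> j" using j k l by (cases j) auto
      moreover have "j \<le> 2 * n * j" using k by simp
      then have "j \<le> N" using j l by linarith
      ultimately show ?thesis by auto
    next
      assume "int (2 * n) dvd int l + int k"
      then have "2 * n dvd l + k" by (metis int_dvd_int_iff of_nat_add)
      then obtain j where j: "l + k = 2 * n * j" by (elim dvdE)
      have "l = lo j" using j by (simp add: lo_def)
      moreover have "1 \<le> j" using j k l by (cases j) auto
      moreover have "2 * j \<le> 2 * n * j" using k by simp
      then have "j \<le> N" using j l k by linarith
      ultimately show ?thesis by auto
    qed
  qed
  have "(\<Sum>l | n < l \<and> l < N \<and> alias_weight n k l \<noteq> 0. 1 / real l ^ p)
      \<le> (\<Sum>l\<in>lo ` {1..N} \<union> hi ` {1..N}. 1 / real l ^ p)"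
    by (rule sum_mono2[OF _ sub]) auto
  also have "\<dots> \<le> (\<Sum>l\<in>lo ` {1..N}. 1 / real l ^ p) + (\<Sum>l\<in>hi ` {1..N}. 1 / real l ^ p)"
    by (subst sum_Un) (auto intro!: sum_nonneg)
  also have "\<dots> \<le> 2 / real n ^ p + 2 / real n ^ p"
  proof (intro add_mono part)
    fix j :: nat assume j: "1 \<le> j"
    show "n * j \<le> hi j" by (simp add: hi_def)
    have "n * 1 \<le> n * j"
      using j by (rule mult_le_mono2)
    moreover have "2 * n * j = n * j + n * j" by simp
    ultimately show "n * j \<le> lo j" unfolding lo_def using k by linarith
  qed
  finally show ?thesis by simp
qed

text \<open>
  Inserting the cosine series into the discrete sum expresses the discrete coefficient as
  \<open>cheb_gamma k\<close> times the sum of \<open>cos_coeff f l * alias_weight n k l\<close> over all \<open>l\<close>. By discrete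
  orthogonality the modes \<open>l \<le> n\<close> produce exactly \<open>cos_coeff f k\<close>; only aliased modes remain.
\<close>

lemma aliasing_error_le:
  assumes k: "k < n" and p: "2 \<le> p" and f: "continuous_on {0..pi} f" and B: "0 \<le> B"
    and decay: "\<And>l. n < l \<Longrightarrow> \<bar>cos_coeff f l\<bar> \<le> B / real l ^ p"
  shows "\<bar>cos_coeff f k
     - cheb_gamma k / real n * (\<Sum>i<n. f (node_angle n i) * cos (real k * node_angle n i))\<bar>
     \<le> 8 * B / real n ^ p"
proof -
  have summ: "summable (\<lambda>l. \<bar>cos_coeff f l\<bar>)"
  proof (rule summable_comparison_test_ev)
    show "summable (\<lambda>l. B * inverse (real l ^ p))"
      by (intro summable_mult inverse_power_summable p)
    show "\<forall>\<^sub>F l in sequentially. norm \<bar>cos_coeff f l\<bar> \<le> B * inverse (real l ^ p)"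
      using eventually_gt_at_top[of n] by eventually_elim (use decay in \<open>auto simp: field_simps\<close>)
  qed
  define e where "e = (\<lambda>l. cos_coeff f l * (cheb_gamma k * alias_weight n k l))"
  have "(\<lambda>l. \<Sum>i<n. cos_coeff f l * cos (real l * node_angle n i) * cos (real k * node_angle n i))
      sums (\<Sum>i<n. f (node_angle n i) * cos (real k * node_angle n i))"
    by (intro sums_sum sums_mult2 cosine_series_sums[OF f summ] node_angle_bounds) auto
  then have "(\<lambda>l. cheb_gamma k / real n * (\<Sum>i<n. cos_coeff f l * cos (real l * node_angle n i) * cos (real k * node_angle n i)))
      sums (cheb_gamma k / real n * (\<Sum>i<n. f (node_angle n i) * cos (real k * node_angle n i)))"
    by (rule sums_mult)
  also have "(\<lambda>l. cheb_gamma k / real n * (\<Sum>i<n. cos_coeff f l * cos (real l * node_angle n i) * cos (real k * node_angle n i))) = e"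
    by (simp add: e_def alias_weight_def fun_eq_iff sum_distrib_left sum_divide_distrib mult_ac)
  finally have "e sums (cheb_gamma k / real n * (\<Sum>i<n. f (node_angle n i) * cos (real k * node_angle n i)))" .
  moreover have "(\<lambda>l. if l = k then cos_coeff f k else 0) sums cos_coeff f k"
    by (rule sums_single)
  ultimately have "(\<lambda>l. e l - (if l = k then cos_coeff f k else 0)) sums
      (cheb_gamma k / real n * (\<Sum>i<n. f (node_angle n i) * cos (real k * node_angle n i)) - cos_coeff f k)"
    (is "?e sums ?E") by (rule sums_diff)
  then have lim: "(\<lambda>N. \<bar>\<Sum>l<N. ?e l\<bar>) \<longlonglongrightarrow> \<bar>?E\<bar>"
    unfolding sums_def by (rule tendsto_rabs)
  have "\<bar>\<Sum>l<N. ?e l\<bar> \<le> 8 * B / real n ^ p" for N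
  proof -
    let ?L = "{l. n < l \<and> l < N \<and> alias_weight n k l \<noteq> 0}"
    have "(\<Sum>l<N. ?e l) = (\<Sum>l\<in>?L. ?e l)"
    proof (rule sum.mono_neutral_right)
      show "\<forall>l\<in>{..<N} - ?L. ?e l = 0"
      proof
        fix l assume l: "l \<in> {..<N} - ?L"
        show "?e l = 0"
        proof (cases "l \<le> n")
          case True
          then show ?thesis using alias_weight_low[OF k True] by (simp add: e_def)
        next
          case False
          then show ?thesis using l k by (auto simp: e_def)
        qed
      qed
    qed auto
    also have "\<bar>\<dots>\<bar> \<le> (\<Sum>l\<in>?L. 2 * B * (1 / real l ^ p))"
    proof (rule sum_abs[THEN order_trans], rule sum_mono)
      fix l assume "l \<in> ?L"
      then have l: "n < l" by simp
      have "\<bar>?e l\<bar> = \<bar>cos_coeff f l\<bar> * (cheb_gamma k * \<bar>alias_weight n k l\<bar>)"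
        using l k by (simp add: e_def abs_mult cheb_gamma_def)
      also have "\<dots> \<le> B / real l ^ p * (2 * 1)"
        using decay[OF l] alias_weight_le_1[of n k l] B
        by (intro mult_mono) (auto simp: cheb_gamma_def)
      finally show "\<bar>?e l\<bar> \<le> 2 * B * (1 / real l ^ p)" by (simp add: mult_ac)
    qed
    also have "\<dots> = 2 * B * (\<Sum>l\<in>?L. 1 / real l ^ p)"
      by (simp only: sum_distrib_left)
    also have "\<dots> \<le> 2 * B * (4 / real n ^ p)"
      using sum_alias_frequencies_le[OF k p, of N] B by (intro mult_left_mono) auto
    finally show ?thesis by (simp add: mult_ac)
  qed
  then have "\<bar>?E\<bar> \<le> 8 * B / real n ^ p"
    by (intro LIMSEQ_le_const2[OF lim]) auto
  then show ?thesis by (simp add: abs_minus_commute)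
qed

section \<open>Decay of the coefficients\<close>

text \<open>
  The integrands that repeated integration by parts of \<open>w (cos x) * cos (l x)\<close> produces. The phase
  advances by a quarter period whenever the power of the sine changes, so that the family is closed
  under integration by parts and the boundary terms on \<open>{0..pi}\<close> vanish: for \<open>b = 0\<close> because
  \<open>sin (l x)\<close> is zero at both ends, for \<open>b > 0\<close> because \<open>sin x\<close> is.
\<close>

definition kern :: "nat \<Rightarrow> nat \<Rightarrow> nat \<Rightarrow> real \<Rightarrow> real" where
  "kern l a b x = cos x ^ a * sin x ^ b * cos (real l * x + real b * (pi / 2))"

lemma continuous_kern: "continuous_on S (kern l a b)"
  unfolding kern_def by (intro continuous_intros)

lemma abs_kern_le_1: "\<bar>kern l a b x\<bar> \<le> 1"
  unfolding kern_def abs_mult power_abs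
  by (intro mult_le_one power_le_one) auto

lemma sin_phase: "sin (y + real b * (pi / 2)) = - cos (y + real (Suc b) * (pi / 2))"
  "0 < b \<Longrightarrow> sin (y + real b * (pi / 2)) = cos (y + real (b - 1) * (pi / 2))"
proof -
  have quarter: "sin z = - cos (z + pi / 2)" "sin (z + pi / 2) = cos z" for z :: real
    by (simp_all add: cos_add sin_add)
  have "y + real (Suc b) * (pi / 2) = (y + real b * (pi / 2)) + pi / 2"
    by (simp add: algebra_simps)
  then show "sin (y + real b * (pi / 2)) = - cos (y + real (Suc b) * (pi / 2))"
    by (simp only: quarter(1))
  assume "0 < b"
  then have "y + real b * (pi / 2) = (y + real (b - 1) * (pi / 2)) + pi / 2"
    by (cases b) (simp_all add: distrib_right add_divide_distrib)
  then show "sin (y + real b * (pi / 2)) = cos (y + real (b - 1) * (pi / 2))"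
    by (simp only: quarter(2))
qed

lemma abs_integral_le:
  fixes f :: "real \<Rightarrow> real"
  assumes "f integrable_on {a..b}" "a \<le> b" "\<And>x. x \<in> {a..b} \<Longrightarrow> \<bar>f x\<bar> \<le> M"
  shows "\<bar>integral {a..b} f\<bar> \<le> M * (b - a)"
  using integral_norm_bound_integral[of f "{a..b}" "\<lambda>_. M"] assms
  by (simp add: integrable_const_ivl mult.commute)

lemma boundary_term_eq_0:
  assumes "x = 0 \<or> x = pi"
  shows "sin x ^ b * sin (real l * x + real b * (pi / 2)) = 0"
  using assms by (cases "b = 0") auto

definition poly_part :: "nat \<Rightarrow> nat \<Rightarrow> real \<Rightarrow> real" where
  "poly_part a b x = cos x ^ a * sin x ^ b"

definition poly_part_deriv :: "nat \<Rightarrow> nat \<Rightarrow> real \<Rightarrow> real" where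
  "poly_part_deriv a b x =
     real b * (cos x ^ Suc a * sin x ^ (b - 1)) - real a * (cos x ^ (a - 1) * sin x ^ Suc b)"

lemma DERIV_poly_part: "(poly_part a b has_real_derivative poly_part_deriv a b x) (at x within S)"
  unfolding poly_part_def poly_part_deriv_def
  by (rule derivative_eq_intros refl)+ (cases a; cases b; simp add: algebra_simps)

lemma poly_part_deriv_times_sin:
  "poly_part_deriv a b x * sin (real l * x + real b * (pi / 2))
     = real b * kern l (Suc a) (b - 1) x + real a * kern l (a - 1) (Suc b) x"
proof (cases "b = 0")
  case True
  show ?thesis
    unfolding poly_part_deriv_def kern_def left_diff_distrib sin_phase(1) using True by (simp add: algebra_simps)
next
  case False
  have "real b * (cos x ^ Suc a * sin x ^ (b - 1)) * sin (real l * x + real b * (pi / 2))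
     = real b * kern l (Suc a) (b - 1) x"
    unfolding kern_def using sin_phase(2)[of b "real l * x"] False by simp
  moreover have "real a * (cos x ^ (a - 1) * sin x ^ Suc b) * sin (real l * x + real b * (pi / 2))
     = - (real a * kern l (a - 1) (Suc b) x)"
    unfolding kern_def sin_phase(1) by simp
  ultimately show ?thesis
    unfolding poly_part_deriv_def left_diff_distrib by simp
qed

text \<open>
  One integration by parts gains the factor \<open>1 / l\<close>, uniformly over all subintervals.
\<close>

lemma abs_integral_kern_le:
  assumes l: "1 \<le> l" and xy: "0 \<le> x" "x \<le> y" "y \<le> pi"
  shows "\<bar>integral {x..y} (kern l a b)\<bar> \<le> 4 * real (a + b + 2) / real l"
proof -
  define S where "S = (\<lambda>t. sin (real l * t + real b * (pi / 2)) / real l)"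
  have S: "(S has_real_derivative cos (real l * t + real b * (pi / 2))) (at t within A)" for t A
    unfolding S_def using l by (auto intro!: derivative_eq_intros)
  have S1: "\<bar>S t\<bar> \<le> 1 / real l" for t
    by (simp add: S_def divide_right_mono)
  have P1: "\<bar>poly_part a b t\<bar> \<le> 1" for t
    unfolding poly_part_def abs_mult power_abs by (intro mult_le_one power_le_one) auto
  have PS: "poly_part_deriv a b t * S t
     = (real b * kern l (Suc a) (b - 1) t + real a * kern l (a - 1) (Suc b) t) / real l" for t
    unfolding S_def using poly_part_deriv_times_sin by (metis times_divide_eq_right)
  have PS1: "\<bar>poly_part_deriv a b t * S t\<bar> \<le> real (a + b) / real l" for t
  proof -
    have "\<bar>real b * kern l (Suc a) (b - 1) t + real a * kern l (a - 1) (Suc b) t\<bar>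
       \<le> \<bar>real b * kern l (Suc a) (b - 1) t\<bar> + \<bar>real a * kern l (a - 1) (Suc b) t\<bar>"
      by (rule abs_triangle_ineq)
    also have "\<dots> \<le> real b * 1 + real a * 1"
      unfolding abs_mult by (intro add_mono mult_mono abs_kern_le_1) auto
    finally show ?thesis
      unfolding PS by (simp add: abs_divide divide_right_mono)
  qed
  have int: "(\<lambda>t. poly_part_deriv a b t * S t) integrable_on {x..y}"
    unfolding PS by (intro integrable_continuous_real continuous_intros continuous_kern)
      (use l in auto)
  have "((\<lambda>t. poly_part_deriv a b t * S t + poly_part a b t * cos (real l * t + real b * (pi / 2)))
     has_integral poly_part a b y * S y - poly_part a b x * S x) {x..y}"
    by (rule fundamental_theorem_of_calculus[OF xy(2)])
      (auto simp: has_real_derivative_iff_has_vector_derivative[symmetric]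
        intro!: derivative_eq_intros DERIV_poly_part S)
  from has_integral_diff[OF this integrable_integral[OF int]]
  have "integral {x..y} (kern l a b) = poly_part a b y * S y - poly_part a b x * S x
      - integral {x..y} (\<lambda>t. poly_part_deriv a b t * S t)"
    by (simp add: kern_def[abs_def] poly_part_def integral_unique)
  also have "\<bar>\<dots>\<bar> \<le> \<bar>poly_part a b y * S y\<bar> + \<bar>poly_part a b x * S x\<bar>
      + \<bar>integral {x..y} (\<lambda>t. poly_part_deriv a b t * S t)\<bar>"
    by linarith
  also have "\<dots> \<le> 1 * (1 / real l) + 1 * (1 / real l) + real (a + b) / real l * (y - x)"
    unfolding abs_mult using int xy PS1
    by (intro add_mono mult_mono P1 S1 abs_integral_le) auto
  also have "\<dots> \<le> 1 * (1 / real l) + 1 * (1 / real l) + real (a + b) / real l * 4"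
    using xy pi_less_4 by (intro add_mono mult_left_mono) auto
  also have "\<dots> \<le> 4 * real (a + b + 2) / real l"
    using l by (simp add: field_simps)
  finally show ?thesis .
qed

text \<open>
  The regularity that the decay estimate needs, on the reference interval: \<open>w 0\<close> has continuous
  derivatives \<open>w 1, \<dots>, w m\<close>, and \<open>w (m + 1)\<close> is the derivative of \<open>w m\<close> up to finitely many points
  and has bounded variation, given as a difference of monotone functions. All quantities are
  controlled by the single number \<open>V\<close>, which carries the power of the length of the subinterval.
\<close>

locale derivative_chain =
  fixes m :: nat and w :: "nat \<Rightarrow> real \<Rightarrow> real" and F G :: "real \<Rightarrow> real"
    and Z :: "real set" and V :: real
  assumes finite_Z: "finite Z"
    and cont_w: "j \<le> m \<Longrightarrow> continuous_on {-1..1} (w j)"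
    and deriv: "j \<le> m \<Longrightarrow> t \<in> {-1<..<1} - Z \<Longrightarrow> (w j has_real_derivative w (Suc j) t) (at t)"
    and top_eq: "t \<in> {-1..1} \<Longrightarrow> w (Suc m) t = F t - G t"
    and mono_F: "mono_on {-1..1} F" and mono_G: "mono_on {-1..1} G"
    and bound_w: "j \<le> Suc m \<Longrightarrow> t \<in> {-1..1} \<Longrightarrow> \<bar>w j t\<bar> \<le> V"
    and bound_F: "t \<in> {-1..1} \<Longrightarrow> \<bar>F t\<bar> \<le> V" and bound_G: "t \<in> {-1..1} \<Longrightarrow> \<bar>G t\<bar> \<le> V"
begin

definition moment :: "nat \<Rightarrow> nat \<Rightarrow> nat \<Rightarrow> nat \<Rightarrow> real" where
  "moment l a b j = integral {0..pi} (\<lambda>x. w j (cos x) * kern l a b x)"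

lemma V_nonneg: "0 \<le> V"
  using bound_F[of 0] by force

text \<open>
  The second mean value theorem bounds the integral against a monotone factor by integrals of the
  kernel alone. Hence the last factor \<open>1 / l\<close> is gained from bounded variation, without
  differentiating \<open>w (m + 1)\<close> and without looking at its jumps.
\<close>

lemma monotone_kern_integral:
  assumes l: "1 \<le> l" and mono: "mono_on {-1..1} H" and bd: "\<And>t. t \<in> {-1..1} \<Longrightarrow> \<bar>H t\<bar> \<le> V"
  shows "(\<lambda>x. H (cos x) * kern l a b x) integrable_on {0..pi}"
    and "\<bar>integral {0..pi} (\<lambda>x. H (cos x) * kern l a b x)\<bar> \<le> 8 * V * real (a + b + 2) / real l"
proof -
  have "- H (cos x) \<le> - H (cos y)" if "0 \<le> x" "x \<le> y" "y \<le> pi" for x y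
    using mono_onD[OF mono, of "cos y" "cos x"] cos_monotone_0_pi_le[of x y] that by auto
  then obtain c where c: "c \<in> {0..pi}" and I: "((\<lambda>x. - H (cos x) * kern l a b x) has_integral
      (- H (cos 0) * integral {0..c} (kern l a b) + - H (cos pi) * integral {c..pi} (kern l a b))) {0..pi}"
    using second_mean_value_theorem_full[OF integrable_continuous_real[OF continuous_kern],
        of 0 pi "\<lambda>x. - H (cos x)" l a b] by auto
  from has_integral_neg[OF I]
  have J: "((\<lambda>x. H (cos x) * kern l a b x) has_integral
      (H 1 * integral {0..c} (kern l a b) + H (-1) * integral {c..pi} (kern l a b))) {0..pi}"
    by (simp add: add.commute)
  then show "(\<lambda>x. H (cos x) * kern l a b x) integrable_on {0..pi}" by blast
  have "\<bar>integral {0..pi} (\<lambda>x. H (cos x) * kern l a b x)\<bar>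
     \<le> \<bar>H 1\<bar> * \<bar>integral {0..c} (kern l a b)\<bar> + \<bar>H (-1)\<bar> * \<bar>integral {c..pi} (kern l a b)\<bar>"
    unfolding integral_unique[OF J] abs_mult[symmetric] by (rule abs_triangle_ineq)
  also have "\<dots> \<le> V * (4 * real (a + b + 2) / real l) + V * (4 * real (a + b + 2) / real l)"
    using c V_nonneg by (intro add_mono mult_mono bd abs_integral_kern_le l) auto
  finally show "\<bar>integral {0..pi} (\<lambda>x. H (cos x) * kern l a b x)\<bar> \<le> 8 * V * real (a + b + 2) / real l"
    by (simp add: algebra_simps)
qed

lemma top_moment_eq:
  assumes "1 \<le> l"
  shows "(\<lambda>x. w (Suc m) (cos x) * kern l a b x) integrable_on {0..pi}"
    and "moment l a b (Suc m) = integral {0..pi} (\<lambda>x. F (cos x) * kern l a b x)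
      - integral {0..pi} (\<lambda>x. G (cos x) * kern l a b x)"
proof -
  have "((\<lambda>x. F (cos x) * kern l a b x - G (cos x) * kern l a b x) has_integral
      integral {0..pi} (\<lambda>x. F (cos x) * kern l a b x)
      - integral {0..pi} (\<lambda>x. G (cos x) * kern l a b x)) {0..pi}"
    by (intro has_integral_diff integrable_integral monotone_kern_integral[OF assms]
        mono_F mono_G bound_F bound_G)
  then have "((\<lambda>x. w (Suc m) (cos x) * kern l a b x) has_integral
      integral {0..pi} (\<lambda>x. F (cos x) * kern l a b x)
      - integral {0..pi} (\<lambda>x. G (cos x) * kern l a b x)) {0..pi}"
    by (rule has_integral_eq[rotated]) (simp add: top_eq left_diff_distrib)
  then show "(\<lambda>x. w (Suc m) (cos x) * kern l a b x) integrable_on {0..pi}"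
    "moment l a b (Suc m) = integral {0..pi} (\<lambda>x. F (cos x) * kern l a b x)
      - integral {0..pi} (\<lambda>x. G (cos x) * kern l a b x)"
    unfolding moment_def by (auto simp: integral_unique)
qed

lemma continuous_w_cos: "j \<le> m \<Longrightarrow> continuous_on {0..pi} (\<lambda>x. w j (cos x))"
  by (rule continuous_on_compose2[OF cont_w]) (auto intro!: continuous_intros)

lemma moment_integrable:
  assumes "1 \<le> l" "j \<le> Suc m"
  shows "(\<lambda>x. w j (cos x) * kern l a b x) integrable_on {0..pi}"
proof (cases "j = Suc m")
  case True
  then show ?thesis using top_moment_eq(1)[OF assms(1)] by simp
next
  case False
  then show ?thesis
    using assms by (intro integrable_continuous_real continuous_intros continuous_w_cos continuous_kern) auto
qed

text \<open>
  Differentiating \<open>cos x ^ a * sin x ^ b * w j (cos x)\<close> gives three terms; each is again, after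
  absorbing the antiderivative of the cosine factor, of the form covered by \<open>moment\<close>.
\<close>

lemma moment_by_parts:
  assumes l: "1 \<le> l" and j: "j \<le> m"
  shows "real l * moment l a b j = - (real b * moment l (Suc a) (b - 1) j
     + real a * moment l (a - 1) (Suc b) j + moment l a (Suc b) (Suc j))"
proof -
  define s where "s = (\<lambda>x. sin (real l * x + real b * (pi / 2)))"
  define p where "p = (\<lambda>x. poly_part a b x * w j (cos x))"
  define p' where "p' = (\<lambda>x. poly_part_deriv a b x * w j (cos x)
      + poly_part a b x * (w (Suc j) (cos x) * (- sin x)))"
  have "((\<lambda>x. p' x * s x) has_integral - (real l * moment l a b j)) {0..pi}"
  proof (rule integration_by_parts_interior_strong[OF bounded_bilinear_mult])
    show "finite (arccos ` Z)" using finite_Z by simp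
    show "continuous_on {0..pi} p"
      unfolding p_def poly_part_def by (intro continuous_intros continuous_w_cos j)
    show "continuous_on {0..pi} s" unfolding s_def by (intro continuous_intros)
    show "(p has_vector_derivative p' x) (at x)" if x: "x \<in> {0<..<pi} - arccos ` Z" for x
    proof -
      have "cos x < 1" "-1 < cos x"
        using x cos_monotone_0_pi[of 0 x] cos_monotone_0_pi[of x pi] by auto
      moreover have "cos x \<notin> Z"
        using x arccos_cos[of x] by (auto simp: image_iff)
      ultimately have "(w j has_real_derivative w (Suc j) (cos x)) (at (cos x))"
        by (intro deriv j) auto
      then have "((\<lambda>x. w j (cos x)) has_real_derivative w (Suc j) (cos x) * (- sin x)) (at x)"
        by (rule DERIV_chain2) (auto intro!: derivative_eq_intros)
      with DERIV_poly_part show ?thesis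
        unfolding has_real_derivative_iff_has_vector_derivative[symmetric] p_def p'_def
        by (auto intro!: derivative_eq_intros)
    qed
    show "(s has_vector_derivative real l * cos (real l * x + real b * (pi / 2))) (at x)" for x
      unfolding has_real_derivative_iff_has_vector_derivative[symmetric] s_def
      by (auto intro!: derivative_eq_intros)
    have "((\<lambda>x. real l * (w j (cos x) * kern l a b x)) has_integral real l * moment l a b j) {0..pi}"
      unfolding moment_def using moment_integrable[OF l, of j] j
      by (intro has_integral_mult_right integrable_integral) auto
    moreover have "p x * s x = 0" if "x = 0 \<or> x = pi" for x
      using boundary_term_eq_0[OF that, of b l] unfolding p_def s_def poly_part_def
      by (metis mult.assoc mult.commute mult_zero_right)
    ultimately have "((\<lambda>x. real l * (w j (cos x) * kern l a b x)) has_integral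
        p pi * s pi - p 0 * s 0 - - (real l * moment l a b j)) {0..pi}"
      by (simp only: simp_thms diff_self diff_minus_eq_add add_0_left)
    moreover have "p x * (real l * cos (real l * x + real b * (pi / 2)))
        = real l * (w j (cos x) * kern l a b x)" for x
      by (simp add: p_def kern_def poly_part_def mult_ac)
    ultimately show "((\<lambda>x. p x * (real l * cos (real l * x + real b * (pi / 2)))) has_integral
        p pi * s pi - p 0 * s 0 - - (real l * moment l a b j)) {0..pi}"
      by (simp only:)
  qed simp
  moreover have "((\<lambda>x. p' x * s x) has_integral
      real b * moment l (Suc a) (b - 1) j + real a * moment l (a - 1) (Suc b) j
      + moment l a (Suc b) (Suc j)) {0..pi}"
  proof -
    have eq: "p' x * s x = real b * (w j (cos x) * kern l (Suc a) (b - 1) x)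
        + real a * (w j (cos x) * kern l (a - 1) (Suc b) x)
        + w (Suc j) (cos x) * kern l a (Suc b) x" for x
    proof -
      have "p' x * s x = w j (cos x) * (poly_part_deriv a b x * s x)
          + w (Suc j) (cos x) * (- (poly_part a b x * sin x * s x))"
        by (simp add: p'_def algebra_simps)
      also have "- (poly_part a b x * sin x * s x) = kern l a (Suc b) x"
        unfolding s_def sin_phase(1) kern_def poly_part_def by simp
      finally show ?thesis
        unfolding s_def poly_part_deriv_times_sin by (simp add: algebra_simps)
    qed
    show ?thesis
      unfolding eq unfolding moment_def using j
      by (intro has_integral_add has_integral_mult_right integrable_integral moment_integrable l) auto
  qed
  ultimately show ?thesis
    by (metis has_integral_unique minus_minus)
qed

text \<open>
  Induction on the number \<open>r\<close> of factors \<open>1 / l\<close> that are claimed. An integration by parts raises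
  \<open>j\<close> and \<open>a + b\<close> by at most one, and its coefficients sum to \<open>a + b + 1\<close>. As
  \<open>a + b + r\<close> does not grow along the recursion, each step costs at most the base of the power on the
  right-hand side. At \<open>j = m + 1\<close> the recursion stops with the second mean
  value theorem, which accounts for the exponent \<open>m + 2\<close> that is reached from \<open>j = 0\<close>.
\<close>

lemma moment_decay:
  assumes l: "1 \<le> l"
  shows "j \<le> Suc m \<Longrightarrow> j + r \<le> m + 2 \<Longrightarrow>
    \<bar>moment l a b j\<bar> \<le> 16 * V * (real (a + b + r + 1) / real l) ^ r"
proof (induction r arbitrary: a b j)
  case 0
  have "\<bar>moment l a b j\<bar> \<le> V * (pi - 0)"
    unfolding moment_def
  proof (rule abs_integral_le)
    show "\<bar>w j (cos x) * kern l a b x\<bar> \<le> V" for x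
      using mult_mono[OF bound_w[OF 0(1), of "cos x"] abs_kern_le_1[of l a b x]] V_nonneg
      by (simp add: abs_mult)
  qed (use moment_integrable[OF l 0(1)] in auto)
  also have "\<dots> \<le> V * 16"
    using V_nonneg pi_less_4 by (intro mult_left_mono) auto
  finally show ?case by simp
next
  case (Suc r)
  show ?case
  proof (cases "j = Suc m")
    case True
    with Suc.prems have "r = 0" by simp
    have "\<bar>moment l a b (Suc m)\<bar> \<le> 8 * V * real (a + b + 2) / real l + 8 * V * real (a + b + 2) / real l"
      unfolding top_moment_eq(2)[OF l]
      using monotone_kern_integral(2)[OF l mono_F bound_F, of a b]
        monotone_kern_integral(2)[OF l mono_G bound_G, of a b] by linarith
    then show ?thesis using True \<open>r = 0\<close> by simp
  next
    case False
    define A where "A = real (a + b + Suc r + 1) / real l"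
    have A: "0 \<le> A" by (simp add: A_def)
    have IH: "\<bar>moment l a' b' j'\<bar> \<le> 16 * V * A ^ r"
      if "a' + b' \<le> a + b + 1" "j' \<le> Suc j" for a' b' j'
    proof -
      have "\<bar>moment l a' b' j'\<bar> \<le> 16 * V * (real (a' + b' + r + 1) / real l) ^ r"
        using that False Suc.prems by (intro Suc.IH) auto
      also have "\<dots> \<le> 16 * V * A ^ r"
        using that V_nonneg unfolding A_def
        by (intro mult_left_mono power_mono divide_right_mono) auto
      finally show ?thesis .
    qed
    have "real l * \<bar>moment l a b j\<bar> = \<bar>real l * moment l a b j\<bar>"
      by (simp add: abs_mult)
    also have "\<dots> = \<bar>real b * moment l (Suc a) (b - 1) j
        + real a * moment l (a - 1) (Suc b) j + moment l a (Suc b) (Suc j)\<bar>"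
      using moment_by_parts[OF l, of j a b] False Suc.prems by simp
    also have "\<dots> \<le> \<bar>real b * moment l (Suc a) (b - 1) j\<bar>
        + \<bar>real a * moment l (a - 1) (Suc b) j\<bar> + \<bar>moment l a (Suc b) (Suc j)\<bar>"
      by linarith
    also have "\<dots> \<le> real b * (16 * V * A ^ r) + real a * (16 * V * A ^ r) + 16 * V * A ^ r"
      unfolding abs_mult using IH[of "Suc a" "b - 1" j] IH[of "a - 1" "Suc b" j] IH[of a "Suc b" "Suc j"]
      by (cases a; cases b) (auto intro!: add_mono mult_left_mono)
    also have "\<dots> = real (a + b + 1) * (16 * V * A ^ r)"
      by (simp add: algebra_simps)
    also have "\<dots> \<le> real (a + b + Suc r + 1) * (16 * V * A ^ r)"
      using V_nonneg A by (intro mult_right_mono) auto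
    also have "\<dots> = real l * (16 * V * A ^ Suc r)"
      using l by (simp add: A_def)
    finally have "real l * \<bar>moment l a b j\<bar> \<le> real l * (16 * V * A ^ Suc r)" .
    then show ?thesis
      using l unfolding A_def by (subst (asm) mult_le_cancel_left_pos) auto
  qed
qed

lemma cos_coeff_decay:
  assumes l: "1 \<le> l"
  shows "\<bar>cos_coeff (\<lambda>x. w 0 (cos x)) l\<bar> \<le> 16 * V * real (m + 3) ^ (m + 2) / real l ^ (m + 2)"
proof -
  have "cos_coeff (\<lambda>x. w 0 (cos x)) l = 2 / pi * moment l 0 0 0"
    using l by (simp add: cos_coeff_def moment_def kern_def cheb_gamma_def)
  also have "\<bar>\<dots>\<bar> = 2 / pi * \<bar>moment l 0 0 0\<bar>"
    by (simp add: abs_mult)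
  also have "\<dots> \<le> 1 * \<bar>moment l 0 0 0\<bar>"
    using pi_ge_two by (intro mult_right_mono) auto
  also have "\<dots> \<le> 16 * V * (real (m + 3) / real l) ^ (m + 2)"
    using moment_decay[OF l, of 0 "m + 2" 0 0] by (simp add: add.commute)
  finally show ?thesis by (simp add: power_divide)
qed

end

section \<open>Taylor remainders on a subinterval\<close>

lemma higher_pderiv_pcompose_shift:
  "(pderiv ^^ j) (pcompose P [:- c, 1:]) = pcompose ((pderiv ^^ j) P) [:- c, 1:]" for c :: real
  by (induction j) (simp_all add: pderiv_pcompose pderiv_pCons)

lemma ex_poly_with_derivatives_at:
  fixes y :: "nat \<Rightarrow> real"
  assumes e: "1 \<le> e"
  obtains p where "degree p \<le> e - 1"
    and "\<And>j. j < e \<Longrightarrow> poly ((pderiv ^^ j) p) c = y j"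
    and "\<And>j. e \<le> j \<Longrightarrow> (pderiv ^^ j) p = 0"
proof -
  define P where "P = (\<Sum>i<e. monom (y i / fact i) i)"
  define p where "p = pcompose P [:- c, 1:]"
  have coeff: "coeff P j = (if j < e then y j / fact j else 0)" for j
    by (simp add: P_def coeff_sum sum.delta)
  have "degree P \<le> e - 1"
    using e by (intro degree_le) (auto simp: coeff)
  moreover have "degree p = degree P" by (simp add: p_def degree_pcompose)
  moreover have "poly ((pderiv ^^ j) p) c = y j" if "j < e" for j
  proof -
    have "poly ((pderiv ^^ j) p) c = coeff ((pderiv ^^ j) P) 0"
      by (simp add: p_def higher_pderiv_pcompose_shift poly_pcompose poly_0_coeff_0)
    also have "\<dots> = y j"
      using that by (simp add: coeff_higher_pderiv coeff pochhammer_fact[symmetric])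
    finally show ?thesis .
  qed
  moreover have "(pderiv ^^ j) p = 0" if "e \<le> j" for j
  proof -
    have "(pderiv ^^ j) P = 0"
      using that by (intro poly_eqI) (simp add: coeff_higher_pderiv coeff)
    then show ?thesis by (simp add: p_def higher_pderiv_pcompose_shift)
  qed
  ultimately show ?thesis using that[of p] by simp
qed

lemma increment_le:
  fixes f f' :: "real \<Rightarrow> real"
  assumes "finite Z" and ab: "a \<le> b" and cont: "continuous_on {a..b} f"
    and der: "\<And>x. x \<in> {a<..<b} - Z \<Longrightarrow> (f has_real_derivative f' x) (at x)"
    and bd: "\<And>x. x \<in> {a..b} \<Longrightarrow> \<bar>f' x\<bar> \<le> M"
  shows "\<bar>f b - f a\<bar> \<le> M * (b - a)"
proof -
  have "(f' has_integral f b - f a) {a..b}"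
    using der unfolding has_real_derivative_iff_has_vector_derivative
    by (intro fundamental_theorem_of_calculus_interior_strong[OF \<open>finite Z\<close> ab _ cont]) auto
  then show ?thesis
    using abs_integral_le[of f' a b M] ab bd by (auto simp: integral_unique)
qed

text \<open>
  For \<open>p\<close> the Taylor polynomial at \<open>a\<close> of degree \<open>e - 1\<close>, the remainders of order \<open>j < e\<close> vanish
  at \<open>a\<close> and have the remainder of order \<open>j + 1\<close> as derivative, so that each step down in \<open>j\<close> gains
  a factor \<open>b - a\<close>. For \<open>j \<ge> e\<close> the truncated exponent \<open>e - j = 0\<close> states that nothing is gained.
\<close>

lemma taylor_remainder_bounds:
  fixes D :: "nat \<Rightarrow> real \<Rightarrow> real"
  assumes Z: "finite Z" and e: "1 \<le> e" "e \<le> N" and ab: "a < b"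
    and cont: "\<And>j. j < N \<Longrightarrow> continuous_on {a..b} (D j)"
    and der: "\<And>j x. j < N \<Longrightarrow> x \<in> {a<..<b} - Z \<Longrightarrow> (D j has_real_derivative D (Suc j) x) (at x)"
    and bd: "\<And>j x. j \<le> N \<Longrightarrow> x \<in> {a..b} \<Longrightarrow> \<bar>D j x\<bar> \<le> S"
  obtains p where "degree p \<le> e - 1" and "\<And>j. e \<le> j \<Longrightarrow> (pderiv ^^ j) p = 0"
    and "\<And>j x. j \<le> N \<Longrightarrow> x \<in> {a..b} \<Longrightarrow>
           \<bar>D j x - poly ((pderiv ^^ j) p) x\<bar> \<le> S * (b - a) ^ (e - j)"
proof -
  obtain p where deg: "degree p \<le> e - 1"
    and low: "\<And>j. j < e \<Longrightarrow> poly ((pderiv ^^ j) p) a = D j a"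
    and high: "\<And>j. e \<le> j \<Longrightarrow> (pderiv ^^ j) p = 0"
    using ex_poly_with_derivatives_at[OF e(1), of a "\<lambda>j. D j a"] by metis
  have S: "0 \<le> S" using bd[of 0 a] ab by force
  \<comment> \<open>Downward induction on the order \<open>j = e - i\<close>.\<close>
  have rem: "\<bar>D (e - i) x - poly ((pderiv ^^ (e - i)) p) x\<bar> \<le> S * (b - a) ^ i"
    if "i \<le> e" "x \<in> {a..b}" for i x
    using that
  proof (induction i arbitrary: x)
    case 0
    then show ?case using high[of e] bd[of e x] e by simp
  next
    case (Suc i)
    define j where "j = e - Suc i"
    have j: "Suc j = e - i" "j < e" using Suc.prems by (auto simp: j_def)
    define r where "r = (\<lambda>j x. D j x - poly ((pderiv ^^ j) p) x)"
    have "\<bar>r j x - r j a\<bar> \<le> S * (b - a) ^ i * (x - a)"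
    proof (rule increment_le[OF Z])
      show "a \<le> x" using Suc.prems by simp
      show "continuous_on {a..x} (r j)"
        unfolding r_def using Suc.prems j e
        by (intro continuous_intros continuous_on_subset[OF cont[of j]]) auto
      show "(r j has_real_derivative r (Suc j) t) (at t)" if "t \<in> {a<..<x} - Z" for t
        unfolding r_def using that Suc.prems j e
        by (auto intro!: derivative_eq_intros der poly_DERIV simp flip: j(1))
      show "\<bar>r (Suc j) t\<bar> \<le> S * (b - a) ^ i" if "t \<in> {a..x}" for t
        unfolding r_def j(1) using that Suc.prems by (intro Suc.IH) auto
    qed
    moreover have "r j a = 0" using low[OF j(2)] by (simp add: r_def)
    moreover have "S * (b - a) ^ i * (x - a) \<le> S * (b - a) ^ i * (b - a)"
      using Suc.prems S ab by (intro mult_left_mono) auto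
    ultimately show ?case by (simp add: r_def j_def[symmetric] mult_ac)
  qed
  have "\<bar>D j x - poly ((pderiv ^^ j) p) x\<bar> \<le> S * (b - a) ^ (e - j)" if "j \<le> N" "x \<in> {a..b}" for j x
  proof (cases "j \<le> e")
    case True
    then show ?thesis using rem[of "e - j" x] that by simp
  next
    case False
    then show ?thesis using high[of j] bd[of j x] that by simp
  qed
  with deg high show ?thesis using that by blast
qed

text \<open>
  Transport to the reference interval. The \<open>j\<close>-th derivative of the pulled back remainder carries
  the factor \<open>(h / 2) ^ j\<close>, which complements the bound \<open>S * h ^ (e - j)\<close> to \<open>S * h ^ e\<close> for all
  orders at once; this is the constant \<open>V\<close> of the decay estimate. The polynomial \<open>p\<close> is invisible
  to the aliased modes.
\<close>

lemma coefficient_error_le: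
  fixes r :: "nat \<Rightarrow> real \<Rightarrow> real" and a b :: real
  defines "h \<equiv> b - a"
  assumes h: "0 < h" "h \<le> 1" and Z: "finite Z" and k: "k < n"
    and cont: "\<And>j. j \<le> m \<Longrightarrow> continuous_on {a..b} (r j)"
    and der: "\<And>j x. j \<le> m \<Longrightarrow> x \<in> {a<..<b} - Z \<Longrightarrow> (r j has_real_derivative r (Suc j) x) (at x)"
    and top: "\<And>x. x \<in> {a..b} \<Longrightarrow> r (Suc m) x = F x - G x"
    and mono: "mono_on {a..b} F" "mono_on {a..b} G"
    and bd: "\<And>j x. j \<le> Suc m \<Longrightarrow> x \<in> {a..b} \<Longrightarrow> \<bar>r j x\<bar> \<le> S * h ^ (e - j)"
    and bdF: "\<And>x. x \<in> {a..b} \<Longrightarrow> \<bar>F x\<bar> \<le> S * h ^ (e - Suc m)"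
    and bdG: "\<And>x. x \<in> {a..b} \<Longrightarrow> \<bar>G x\<bar> \<le> S * h ^ (e - Suc m)"
    and u: "\<And>x. x \<in> {a..b} \<Longrightarrow> u x = r 0 x + poly p x" and deg: "degree p \<le> n"
  shows "\<bar>cheb_coeff (pullback u a b) k - disc_cheb_coeff n (pullback u a b) k\<bar>
    \<le> 128 * real (m + 3) ^ (m + 2) * S * (h ^ e / real n ^ (m + 2))"
proof -
  define \<sigma> where "\<sigma> = (\<lambda>t. h / 2 * t + (a + b) / 2)"
  have \<sigma>: "\<sigma> t \<in> {a..b}" if "t \<in> {-1..1}" for t
  proof -
    have "h / 2 * (-1) \<le> h / 2 * t" "h / 2 * t \<le> h / 2 * 1"
      using that h by (intro mult_left_mono; simp)+
    then show ?thesis by (simp add: \<sigma>_def h_def field_simps)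
  qed
  have \<sigma>': "\<sigma> t \<in> {a<..<b}" if "t \<in> {-1<..<1}" for t
  proof -
    have "h / 2 * (-1) < h / 2 * t" "h / 2 * t < h / 2 * 1"
      using that h by (intro mult_strict_left_mono; simp)+
    then show ?thesis by (simp add: \<sigma>_def h_def field_simps)
  qed
  have \<sigma>_mono: "\<sigma> s \<le> \<sigma> t" if "s \<le> t" for s t
    using that h by (simp add: \<sigma>_def)
  have \<sigma>_cont: "continuous_on A \<sigma>" for A
    unfolding \<sigma>_def by (intro continuous_intros)
  have S: "0 \<le> S"
  proof -
    have "0 \<le> S * h ^ (e - 0)"
      using bd[of 0 a] h by (auto simp: h_def)
    moreover have "0 < h ^ e" using h by simp
    ultimately show ?thesis by (simp add: zero_le_mult_iff)
  qed
  define w where "w = (\<lambda>j t. (h / 2) ^ j * r j (\<sigma> t))"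
  have scale: "\<bar>(h / 2) ^ j * y\<bar> \<le> S * h ^ e" if "\<bar>y\<bar> \<le> S * h ^ (e - j)" for j y
  proof -
    have "\<bar>(h / 2) ^ j * y\<bar> \<le> h ^ j * (S * h ^ (e - j))"
      unfolding abs_mult using that h by (intro mult_mono) (auto intro: power_mono)
    also have "\<dots> = S * h ^ (j + (e - j))"
      by (simp add: power_add)
    also have "\<dots> \<le> S * h ^ e"
      using h S by (intro mult_left_mono power_decreasing) auto
    finally show ?thesis .
  qed
  interpret derivative_chain m w "\<lambda>t. (h / 2) ^ Suc m * F (\<sigma> t)" "\<lambda>t. (h / 2) ^ Suc m * G (\<sigma> t)"
    "\<sigma> -` Z" "S * h ^ e"
  proof
    show "finite (\<sigma> -` Z)"
      using Z h by (intro finite_vimageI) (auto simp: inj_def \<sigma>_def)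
    show "continuous_on {-1..1} (w j)" if "j \<le> m" for j
      unfolding w_def using \<sigma>
      by (intro continuous_intros continuous_on_compose2[OF cont[OF that] \<sigma>_cont]) auto
    show "(w j has_real_derivative w (Suc j) t) (at t)"
      if "j \<le> m" "t \<in> {-1<..<1} - \<sigma> -` Z" for j t
    proof -
      have "(r j has_real_derivative r (Suc j) (\<sigma> t)) (at (\<sigma> t))"
        using that \<sigma>'[of t] by (intro der) auto
      moreover have "(\<sigma> has_real_derivative h / 2) (at t)"
        unfolding \<sigma>_def by (auto intro!: derivative_eq_intros)
      ultimately have "((\<lambda>t. r j (\<sigma> t)) has_real_derivative r (Suc j) (\<sigma> t) * (h / 2)) (at t)"
        by (rule DERIV_chain2)
      then show ?thesis
        unfolding w_def by (auto intro!: derivative_eq_intros)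
    qed
    show "w (Suc m) t = (h / 2) ^ Suc m * F (\<sigma> t) - (h / 2) ^ Suc m * G (\<sigma> t)" if "t \<in> {-1..1}" for t
      unfolding w_def top[OF \<sigma>[OF that]] by (rule right_diff_distrib)
    show "mono_on {-1..1} (\<lambda>t. (h / 2) ^ Suc m * F (\<sigma> t))"
      using h by (intro mono_onI mult_left_mono mono_onD[OF mono(1)] \<sigma> \<sigma>_mono) auto
    show "mono_on {-1..1} (\<lambda>t. (h / 2) ^ Suc m * G (\<sigma> t))"
      using h by (intro mono_onI mult_left_mono mono_onD[OF mono(2)] \<sigma> \<sigma>_mono) auto
    show "\<bar>w j t\<bar> \<le> S * h ^ e" if "j \<le> Suc m" "t \<in> {-1..1}" for j t
      unfolding w_def by (intro scale bd that \<sigma>)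
    show "\<bar>(h / 2) ^ Suc m * F (\<sigma> t)\<bar> \<le> S * h ^ e" if "t \<in> {-1..1}" for t
      by (intro scale bdF that \<sigma>)
    show "\<bar>(h / 2) ^ Suc m * G (\<sigma> t)\<bar> \<le> S * h ^ e" if "t \<in> {-1..1}" for t
      by (intro scale bdG that \<sigma>)
  qed
  define v where "v = pullback u a b"
  define q where "q = pcompose p [:(a + b) / 2, h / 2:]"
  have v: "v t = w 0 t + poly q t" if "t \<in> {-1..1}" for t
    using u[OF \<sigma>[OF that]]
    by (simp add: v_def pullback_def w_def q_def poly_pcompose \<sigma>_def h_def mult.commute add.commute)
  have v_cont: "continuous_on {-1..1} v"
  proof -
    have "continuous_on {-1..1} (\<lambda>t. w 0 t + poly q t)"
      by (intro continuous_intros cont_w) auto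
    then show ?thesis by (rule continuous_on_eq) (simp add: v)
  qed
  have "degree q \<le> n"
    using deg h by (simp add: q_def degree_pcompose)
  have tail: "cos_coeff (\<lambda>x. v (cos x)) l = cos_coeff (\<lambda>x. w 0 (cos x)) l" if "n < l" for l
  proof -
    have "integral {0..pi} (\<lambda>x. v (cos x) * cos (real l * x))
        = integral {0..pi} (\<lambda>x. w 0 (cos x) * cos (real l * x) + poly q (cos x) * cos (real l * x))"
      by (intro integral_cong) (simp add: v algebra_simps)
    also have "\<dots> = integral {0..pi} (\<lambda>x. w 0 (cos x) * cos (real l * x))
        + integral {0..pi} (\<lambda>x. poly q (cos x) * cos (real l * x))"
      by (intro integral_add integrable_continuous_real continuous_intros continuous_w_cos) auto
    also have "integral {0..pi} (\<lambda>x. poly q (cos x) * cos (real l * x)) = 0"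
      using \<open>degree q \<le> n\<close> that by (intro integral_poly_cos_eq_0) auto
    finally show ?thesis by (simp add: cos_coeff_def)
  qed
  have "\<bar>cos_coeff (\<lambda>x. v (cos x)) k
      - cheb_gamma k / real n * (\<Sum>i<n. v (cos (node_angle n i)) * cos (real k * node_angle n i))\<bar>
      \<le> 8 * (16 * (S * h ^ e) * real (m + 3) ^ (m + 2)) / real n ^ (m + 2)"
  proof (rule aliasing_error_le[OF k])
    show "continuous_on {0..pi} (\<lambda>x. v (cos x))"
      by (rule continuous_on_compose2[OF v_cont]) (auto intro!: continuous_intros)
    show "\<bar>cos_coeff (\<lambda>x. v (cos x)) l\<bar>
        \<le> 16 * (S * h ^ e) * real (m + 3) ^ (m + 2) / real l ^ (m + 2)" if "n < l" for l
      unfolding tail[OF that] using that by (intro cos_coeff_decay) auto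
  qed (use S h in auto)
  also have "cos_coeff (\<lambda>x. v (cos x)) k = cheb_coeff v k"
    by (rule cheb_coeff_eq_cos_coeff[OF v_cont, symmetric])
  also have "cheb_gamma k / real n * (\<Sum>i<n. v (cos (node_angle n i)) * cos (real k * node_angle n i))
      = disc_cheb_coeff n v k"
    by (simp add: disc_cheb_coeff_def cheb_node_eq_cos poly_cheb_poly_cos atLeast0LessThan)
  finally show ?thesis by (simp add: v_def mult_ac)
qed

section \<open>Piecewise smooth functions\<close>

text \<open>
  A function that is Lipschitz between finitely many break points and bounded has bounded variation.
  The added function \<open>G\<close> has slope \<open>S\<close>, which compensates the decrease between break points, and a
  jump of at least \<open>2 S\<close> at each of them.
\<close>

lemma mono_on_compensated:
  fixes E :: "real \<Rightarrow> real"
  assumes Z: "finite Z" and S: "0 \<le> S"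
    and bd: "\<And>x. x \<in> {A..B} \<Longrightarrow> \<bar>E x\<bar> \<le> S"
    and lip: "\<And>x y. A \<le> x \<Longrightarrow> x \<le> y \<Longrightarrow> y \<le> B \<Longrightarrow> {x..y} \<inter> Z = {} \<Longrightarrow> \<bar>E y - E x\<bar> \<le> S * (y - x)"
  obtains G where "mono_on {A..B} G" "mono_on {A..B} (\<lambda>x. E x + G x)"
proof -
  \<comment> \<open>Counting both \<open>z < x\<close> and \<open>z \<le> x\<close> makes \<open>N\<close> jump on either side of a break point, where \<open>E\<close> may take any value.\<close>
  define N where "N = (\<lambda>x. card {z\<in>Z. z < x} + card {z\<in>Z. z \<le> x})"
  define G where "G = (\<lambda>x. S * x + 2 * S * real (N x))"
  have N_mono: "N x \<le> N y" if "x \<le> y" for x y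
    unfolding N_def using Z that by (intro add_mono card_mono) auto
  have N_jump: "N x + 1 \<le> N y" if "x < y" "z \<in> Z" "x \<le> z" "z \<le> y" for x y z
  proof (cases "z = x")
    case True
    have "card {z\<in>Z. z < x} < card {z\<in>Z. z < y}"
      using Z that True by (intro psubset_card_mono) auto
    moreover have "card {z\<in>Z. z \<le> x} \<le> card {z\<in>Z. z \<le> y}"
      using Z that by (intro card_mono) auto
    ultimately show ?thesis by (simp add: N_def)
  next
    case False
    have "card {z\<in>Z. z \<le> x} < card {z\<in>Z. z \<le> y}"
    proof (rule psubset_card_mono)
      have "z \<in> {z\<in>Z. z \<le> y}" "z \<notin> {z\<in>Z. z \<le> x}" using that False by auto
      moreover have "{z\<in>Z. z \<le> x} \<subseteq> {z\<in>Z. z \<le> y}" using that by auto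
      ultimately show "{z\<in>Z. z \<le> x} \<subset> {z\<in>Z. z \<le> y}" by blast
    qed (use Z in simp)
    moreover have "card {z\<in>Z. z < x} \<le> card {z\<in>Z. z < y}"
      using Z that by (intro card_mono) auto
    ultimately show ?thesis by (simp add: N_def)
  qed
  have "mono_on {A..B} G"
    using S N_mono unfolding G_def by (intro mono_onI add_mono mult_left_mono) auto
  moreover have "mono_on {A..B} (\<lambda>x. E x + G x)"
  proof (rule mono_onI)
    fix x y assume xy: "x \<in> {A..B}" "y \<in> {A..B}" "x \<le> y"
    show "E x + G x \<le> E y + G y"
    proof (cases "x = y \<or> {x..y} \<inter> Z = {}")
      case True
      then have "E x - E y \<le> S * (y - x)"
        using lip[of x y] xy by auto
      moreover have "2 * S * real (N x) \<le> 2 * S * real (N y)"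
        using N_mono[OF xy(3)] S by (intro mult_left_mono) auto
      ultimately show ?thesis by (simp add: G_def algebra_simps)
    next
      case False
      then obtain z where "z \<in> Z" "x \<le> z" "z \<le> y" "x < y" using xy by auto
      then have "2 * S * (real (N x) + 1) \<le> 2 * S * real (N y)"
        using N_jump[of x y z] S by (intro mult_left_mono) auto
      moreover have "S * x \<le> S * y" using xy S by (intro mult_left_mono) auto
      moreover have "E x - E y \<le> 2 * S" using bd[OF xy(1)] bd[OF xy(2)] by linarith
      ultimately show ?thesis by (simp add: G_def algebra_simps)
    qed
  qed
  ultimately show ?thesis using that by blast
qed

lemma mono_on_abs_le:
  fixes F :: "real \<Rightarrow> real"
  assumes "mono_on {A..B} F" "x \<in> {A..B}"
  shows "\<bar>F x\<bar> \<le> max \<bar>F A\<bar> \<bar>F B\<bar>"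
  using mono_onD[OF assms(1), of A x] mono_onD[OF assms(1), of x B] assms(2) by auto

lemma continuous_family_bounded:
  fixes D :: "nat \<Rightarrow> real \<Rightarrow> real"
  assumes "\<And>j. j \<le> N \<Longrightarrow> continuous_on {A..B} (D j)"
  obtains S where "0 < S" "\<And>j x. j \<le> N \<Longrightarrow> x \<in> {A..B} \<Longrightarrow> \<bar>D j x\<bar> \<le> S"
proof -
  have "bounded (\<Union>j\<in>{..N}. D j ` {A..B})"
    by (intro bounded_UN ballI finite_atMost compact_imp_bounded compact_continuous_image assms
        compact_Icc) simp
  then obtain S where S: "\<forall>y\<in>\<Union>j\<in>{..N}. D j ` {A..B}. \<bar>y\<bar> \<le> S"
    unfolding bounded_real by (elim exE)
  have "\<bar>D j x\<bar> \<le> max S 1" if "j \<le> N" "x \<in> {A..B}" for j x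
  proof (rule max.coboundedI1)
    have "D j x \<in> (\<Union>j\<in>{..N}. D j ` {A..B})" using that by (intro UN_I[of j] imageI) auto
    with S show "\<bar>D j x\<bar> \<le> S" by (rule bspec)
  qed
  then show ?thesis using that[of "max S 1"] by (simp add: less_max_iff_disj)
qed

lemma Ck_on_derivatives:
  assumes "Ck_on N f {a..b}"
  obtains D where "\<And>x. x \<in> {a..b} \<Longrightarrow> D 0 x = f x"
    and "\<And>j. j \<le> N \<Longrightarrow> continuous_on {a..b} (D j)"
    and "\<And>j x. j < N \<Longrightarrow> x \<in> {a<..<b} \<Longrightarrow> (D j has_real_derivative D (Suc j) x) (at x)"
proof -
  obtain D where D0: "\<forall>x\<in>{a..b}. D 0 x = f x"
    and D: "\<forall>j<N. \<forall>x\<in>{a..b}. (D j has_real_derivative D (Suc j) x) (at x within {a..b})"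
    and DN: "continuous_on {a..b} (D N)"
    using assms unfolding Ck_on_def by blast
  have "continuous_on {a..b} (D j)" if "j \<le> N" for j
  proof (cases "j = N")
    case False
    then show ?thesis using D that DERIV_continuous_on[of "{a..b}" "D j" "D (Suc j)"] by auto
  qed (use DN in simp)
  moreover have "(D j has_real_derivative D (Suc j) x) (at x)" if "j < N" "x \<in> {a<..<b}" for j x
    using D[rule_format, of j x] that at_within_Icc_at[of a x b] by simp
  ultimately show ?thesis using D0 that by blast
qed

text \<open>
  On an open piece the globally given derivatives up to order \<open>m\<close> coincide with those of the smooth
  representative \<open>g\<close>, by uniqueness of derivatives. This provides two further derivatives there,
  bounded because those of \<open>g\<close> extend continuously to the closed piece.
\<close>

lemma Ck_piece_derivatives:
  assumes g: "Ck_on (m + 2) g {p..q}"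
    and D0: "\<And>x. x \<in> {p<..<q} \<Longrightarrow> D 0 x = g x"
    and der: "\<And>j x. j < m \<Longrightarrow> x \<in> {p<..<q} \<Longrightarrow> (D j has_real_derivative D (Suc j) x) (at x)"
  obtains M where "0 \<le> M"
    and "\<And>x. x \<in> {p<..<q} \<Longrightarrow> (D m has_real_derivative deriv (D m) x) (at x)"
    and "\<And>x. x \<in> {p<..<q} \<Longrightarrow> \<bar>deriv (D m) x\<bar> \<le> M"
    and "\<And>x. x \<in> {p<..<q} \<Longrightarrow> \<exists>d. (deriv (D m) has_real_derivative d) (at x) \<and> \<bar>d\<bar> \<le> M"
proof -
  obtain H where H0: "\<And>x. x \<in> {p..q} \<Longrightarrow> H 0 x = g x"
    and Hc: "\<And>j. j \<le> m + 2 \<Longrightarrow> continuous_on {p..q} (H j)"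
    and H: "\<And>j x. j < m + 2 \<Longrightarrow> x \<in> {p<..<q} \<Longrightarrow> (H j has_real_derivative H (Suc j) x) (at x)"
    using Ck_on_derivatives[OF g] by blast
  obtain M where M: "0 < M" "\<And>j x. j \<le> m + 2 \<Longrightarrow> x \<in> {p..q} \<Longrightarrow> \<bar>H j x\<bar> \<le> M"
    using continuous_family_bounded[of "m + 2" p q H] Hc by blast
  have eq: "D j x = H j x" if "j \<le> m" "x \<in> {p<..<q}" for j x
    using that
  proof (induction j arbitrary: x)
    case 0
    then show ?case using D0 H0 by simp
  next
    case (Suc j)
    have "(H j has_real_derivative D (Suc j) x) (at x)"
    proof (rule has_field_derivative_transform_within_open)
      show "(D j has_real_derivative D (Suc j) x) (at x)" using der Suc.prems by simp
      show "D j y = H j y" if "y \<in> {p<..<q}" for y using Suc.IH Suc.prems that by simp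
    qed (use Suc.prems in auto)
    moreover have "(H j has_real_derivative H (Suc j) x) (at x)" using H Suc.prems by simp
    ultimately show ?case by (rule DERIV_unique)
  qed
  have Dm: "(D m has_real_derivative H (Suc m) x) (at x)" if "x \<in> {p<..<q}" for x
    by (rule has_field_derivative_transform_within_open[OF H, of _ _ "{p<..<q}"])
      (use that eq in auto)
  have dm: "deriv (D m) x = H (Suc m) x" if "x \<in> {p<..<q}" for x
    using DERIV_imp_deriv[OF Dm[OF that]] .
  have "(deriv (D m) has_real_derivative H (m + 2) x) (at x)" if "x \<in> {p<..<q}" for x
    by (rule has_field_derivative_transform_within_open[of "H (Suc m)" _ _ "{p<..<q}"])
      (use that dm H[of "Suc m" x] in auto)
  moreover have "\<bar>H (m + 2) x\<bar> \<le> M" if "x \<in> {p<..<q}" for x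
    using M(2)[of "m + 2" x] that by simp
  ultimately have "\<exists>d. (deriv (D m) has_real_derivative d) (at x) \<and> \<bar>d\<bar> \<le> M"
    if "x \<in> {p<..<q}" for x
    using that by blast
  moreover have "\<bar>deriv (D m) x\<bar> \<le> M" if "x \<in> {p<..<q}" for x
    using M(2)[of "Suc m" x] dm that by simp
  moreover have "(D m has_real_derivative deriv (D m) x) (at x)" if "x \<in> {p<..<q}" for x
    unfolding dm[OF that] by (rule Dm[OF that])
  ultimately show ?thesis using that[of M] M(1) by simp
qed

text \<open>
  Here \<open>Z\<close> collects the end points of the pieces, and \<open>D (m + 1)\<close> is set to \<open>0\<close> on \<open>Z\<close>.
\<close>

lemma X_space_derivatives:
  assumes u: "u \<in> X_space m {A..B}"
  obtains Z D F G S where "finite Z" "\<And>x. x \<in> {A..B} \<Longrightarrow> D 0 x = u x"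
    and "\<And>j. j \<le> m \<Longrightarrow> continuous_on {A..B} (D j)"
    and "\<And>j x. j \<le> m \<Longrightarrow> x \<in> {A<..<B} - Z \<Longrightarrow> (D j has_real_derivative D (Suc j) x) (at x)"
    and "\<And>x. D (Suc m) x = F x - G x"
    and "mono_on {A..B} F" "mono_on {A..B} G" "0 < S"
    and "\<And>j x. j \<le> Suc m \<Longrightarrow> x \<in> {A..B} \<Longrightarrow> \<bar>D j x\<bar> \<le> S"
    and "\<And>x. x \<in> {A..B} \<Longrightarrow> \<bar>F x\<bar> \<le> S" "\<And>x. x \<in> {A..B} \<Longrightarrow> \<bar>G x\<bar> \<le> S"
proof -
  have Ck: "Ck_on m u {A..B}" and pw: "piecewise_Ck_on (m + 2) u {A..B}"
    using u by (auto simp: X_space_def)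
  obtain D where D0: "\<And>x. x \<in> {A..B} \<Longrightarrow> D 0 x = u x"
    and Dc: "\<And>j. j \<le> m \<Longrightarrow> continuous_on {A..B} (D j)"
    and D: "\<And>j x. j < m \<Longrightarrow> x \<in> {A<..<B} \<Longrightarrow> (D j has_real_derivative D (Suc j) x) (at x)"
    using Ck_on_derivatives[OF Ck] by blast
  obtain P where P: "P division_of {A..B}"
    and Pg: "\<And>K. K \<in> P \<Longrightarrow> \<exists>g. Ck_on (m + 2) g K \<and> (\<forall>x\<in>interior K. u x = g x)"
    using pw unfolding piecewise_Ck_on_def by blast
  have "\<exists>M\<ge>0. \<forall>x\<in>interior K. (D m has_real_derivative deriv (D m) x) (at x) \<and> \<bar>deriv (D m) x\<bar> \<le> M
      \<and> (\<exists>d. (deriv (D m) has_real_derivative d) (at x) \<and> \<bar>d\<bar> \<le> M)" if K: "K \<in> P" for K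
  proof -
    obtain p q where pq: "K = {p..q}" using division_ofD(4)[OF P K] by (metis cbox_interval)
    obtain g where g: "Ck_on (m + 2) g {p..q}" "\<And>x. x \<in> {p<..<q} \<Longrightarrow> u x = g x"
      using Pg[OF K] unfolding pq interior_atLeastAtMost_real by blast
    have sub: "{p<..<q} \<subseteq> {A<..<B}"
      using interior_mono[OF division_ofD(2)[OF P K]] unfolding pq by simp
    have D0': "D 0 x = g x" if "x \<in> {p<..<q}" for x
      using sub that g(2)[OF that] D0[of x] by force
    have D': "(D j has_real_derivative D (Suc j) x) (at x)" if "j < m" "x \<in> {p<..<q}" for j x
      using D[of j x] that sub by blast
    obtain M where M: "0 \<le> M"
      and der: "\<And>x. x \<in> {p<..<q} \<Longrightarrow> (D m has_real_derivative deriv (D m) x) (at x)"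
      and bd1: "\<And>x. x \<in> {p<..<q} \<Longrightarrow> \<bar>deriv (D m) x\<bar> \<le> M"
      and bd2: "\<And>x. x \<in> {p<..<q} \<Longrightarrow> \<exists>d. (deriv (D m) has_real_derivative d) (at x) \<and> \<bar>d\<bar> \<le> M"
      using Ck_piece_derivatives[OF g(1), of D, OF D0' D'] by blast
    have "interior K = {p<..<q}" by (simp add: pq)
    then show ?thesis
      using M der bd1 bd2 by (intro exI[of _ M]) simp
  qed
  then obtain M where M: "\<And>K. K \<in> P \<Longrightarrow> 0 \<le> M K"
    and MD: "\<And>K x. K \<in> P \<Longrightarrow> x \<in> interior K \<Longrightarrow>
      (D m has_real_derivative deriv (D m) x) (at x) \<and> \<bar>deriv (D m) x\<bar> \<le> M K
      \<and> (\<exists>d. (deriv (D m) has_real_derivative d) (at x) \<and> \<bar>d\<bar> \<le> M K)"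
    by metis
  have finP: "finite P" using P by (rule division_of_finite)
  define T where "T = sum M P"
  have T: "0 \<le> T" unfolding T_def using M by (rule sum_nonneg)
  have MT: "M K \<le> T" if "K \<in> P" for K
    unfolding T_def using M finP that by (intro member_le_sum) auto
  define Z where "Z = (\<Union>K\<in>P. K - interior K)"
  have Z: "finite Z"
    unfolding Z_def
  proof (intro finite_UN_I finP)
    fix K assume "K \<in> P"
    then obtain p q where "K = {p..q}" using division_ofD(4)[OF P] by (metis cbox_interval)
    then have "K - interior K \<subseteq> {p, q}" by auto
    then show "finite (K - interior K)" by (rule finite_subset) simp
  qed
  have off: "(D m has_real_derivative deriv (D m) x) (at x) \<and> \<bar>deriv (D m) x\<bar> \<le> T
      \<and> (\<exists>d. (deriv (D m) has_real_derivative d) (at x) \<and> \<bar>d\<bar> \<le> T)"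
    if "x \<in> {A..B}" "x \<notin> Z" for x
  proof -
    have "x \<in> \<Union>P" using division_ofD(6)[OF P] that(1) by simp
    then obtain K where K: "K \<in> P" "x \<in> K" by (elim UnionE)
    then have "x \<in> interior K" using that(2) by (auto simp: Z_def)
    then show ?thesis using MD[OF K(1)] MT[OF K(1)] by (meson order_trans)
  qed
  define E where "E = (\<lambda>x. if x \<in> Z then 0 else deriv (D m) x)"
  have E_bd: "\<bar>E x\<bar> \<le> T" if "x \<in> {A..B}" for x
    using off[OF that] T by (auto simp: E_def)
  have E_lip: "\<bar>E y - E x\<bar> \<le> T * (y - x)"
    if xy: "A \<le> x" "x \<le> y" "y \<le> B" "{x..y} \<inter> Z = {}" for x y
  proof -
    have "\<exists>d. (E has_real_derivative d) (at t) \<and> \<bar>d\<bar> \<le> T" if t: "t \<in> {x..y}" for t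
    proof -
      have "t \<in> {A..B}" "t \<notin> Z" using t xy by auto
      with off obtain d where d: "(deriv (D m) has_real_derivative d) (at t)" "\<bar>d\<bar> \<le> T" by blast
      have "(E has_real_derivative d) (at t)"
        by (rule has_field_derivative_transform_within_open[OF d(1), of "- Z"])
          (use \<open>t \<notin> Z\<close> finite_imp_closed[OF Z] in \<open>auto simp: E_def\<close>)
      with d show ?thesis by blast
    qed
    then obtain d where d: "\<And>t. t \<in> {x..y} \<Longrightarrow> (E has_real_derivative d t) (at t)"
      "\<And>t. t \<in> {x..y} \<Longrightarrow> \<bar>d t\<bar> \<le> T" by metis
    show ?thesis
    proof (rule increment_le[of "{}" x y E d])
      show "continuous_on {x..y} E"
        using d(1) by (intro continuous_at_imp_continuous_on ballI DERIV_isCont) blast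
    qed (use d xy in auto)
  qed
  obtain G where G: "mono_on {A..B} G" "mono_on {A..B} (\<lambda>x. E x + G x)"
    using mono_on_compensated[OF Z T E_bd E_lip] by blast
  obtain S0 where S0: "0 < S0" "\<And>j x. j \<le> m \<Longrightarrow> x \<in> {A..B} \<Longrightarrow> \<bar>D j x\<bar> \<le> S0"
    using continuous_family_bounded[of m A B D] Dc by blast
  define F where "F = (\<lambda>x. E x + G x)"
  define S where "S = S0 + T + max \<bar>F A\<bar> \<bar>F B\<bar> + max \<bar>G A\<bar> \<bar>G B\<bar>"
  define D' where "D' = (\<lambda>j. if j \<le> m then D j else E)"
  have nonneg: "0 \<le> max \<bar>F A\<bar> \<bar>F B\<bar>" "0 \<le> max \<bar>G A\<bar> \<bar>G B\<bar>" by auto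
  show ?thesis
  proof (rule that[of Z D' F G S])
    show "(D' j has_real_derivative D' (Suc j) x) (at x)" if "j \<le> m" "x \<in> {A<..<B} - Z" for j x
    proof (cases "j = m")
      case True
      then show ?thesis using off[of x] that by (auto simp: D'_def E_def)
    next
      case False
      then show ?thesis using D[of j x] that by (auto simp: D'_def)
    qed
    show "\<bar>D' j x\<bar> \<le> S" if "j \<le> Suc m" "x \<in> {A..B}" for j x
    proof (cases "j \<le> m")
      case True
      then have "\<bar>D' j x\<bar> \<le> S0" using S0(2)[of j x] that by (simp add: D'_def)
      then show ?thesis using nonneg T unfolding S_def by linarith
    next
      case False
      then have "\<bar>D' j x\<bar> \<le> T" using E_bd[OF that(2)] by (simp add: D'_def)
      then show ?thesis using nonneg S0(1) unfolding S_def by linarith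
    qed
    show F: "mono_on {A..B} F" using G(2) by (simp add: F_def)
    show "\<bar>F x\<bar> \<le> S" if "x \<in> {A..B}" for x
      using mono_on_abs_le[OF F that] nonneg S0(1) T unfolding S_def by linarith
    show "\<bar>G x\<bar> \<le> S" if "x \<in> {A..B}" for x
      using mono_on_abs_le[OF G(1) that] nonneg S0(1) T unfolding S_def by linarith
    show "0 < S" using S0(1) T nonneg by (simp add: S_def)
    show "D' 0 x = u x" if "x \<in> {A..B}" for x using D0[OF that] by (simp add: D'_def)
    show "continuous_on {A..B} (D' j)" if "j \<le> m" for j using Dc[OF that] that by (simp add: D'_def)
    show "D' (Suc m) x = F x - G x" for x by (simp add: D'_def F_def)
  qed (fact Z G(1))+
qed

section \<open>The error bounds\<close>

text \<open>
  As \<open>D (m + 1)\<close> may jump, only polynomials of degree at most \<open>m\<close> are removed, and the monotone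
  parts \<open>F\<close> and \<open>G\<close> need not be small. For this derivative the factor \<open>h ^ (m + 1)\<close> comes from the pullback alone.
\<close>

lemma error_bound_X_space:
  assumes "u \<in> X_space m {A..B}"
  shows "\<exists>C>0. \<forall>a b h :: real. \<forall>n k :: nat.
    {a..b} \<subseteq> {A..B} \<and> h = b - a \<and> 0 < h \<and> h \<le> 1 \<and> 1 \<le> n \<and> k \<le> n - 1 \<longrightarrow>
    \<bar>cheb_coeff (pullback u a b) k - disc_cheb_coeff n (pullback u a b) k\<bar>
      \<le> C * (h ^ min (n + 1) (m + 1) / real n ^ (m + 2))"
proof -
  obtain Z D F G S where Z: "finite Z" and D0: "\<And>x. x \<in> {A..B} \<Longrightarrow> D 0 x = u x"
    and Dc: "\<And>j. j \<le> m \<Longrightarrow> continuous_on {A..B} (D j)"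
    and D: "\<And>j x. j \<le> m \<Longrightarrow> x \<in> {A<..<B} - Z \<Longrightarrow> (D j has_real_derivative D (Suc j) x) (at x)"
    and top: "\<And>x. D (Suc m) x = F x - G x"
    and mono: "mono_on {A..B} F" "mono_on {A..B} G" and S: "0 < S"
    and bd: "\<And>j x. j \<le> Suc m \<Longrightarrow> x \<in> {A..B} \<Longrightarrow> \<bar>D j x\<bar> \<le> S"
    and bdFG: "\<And>x. x \<in> {A..B} \<Longrightarrow> \<bar>F x\<bar> \<le> S" "\<And>x. x \<in> {A..B} \<Longrightarrow> \<bar>G x\<bar> \<le> S"
    by (fact X_space_derivatives[OF assms])
  show ?thesis
  proof (intro exI[of _ "128 * real (m + 3) ^ (m + 2) * S"] conjI allI impI)
    fix a b h :: real and n k :: nat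
    assume *: "{a..b} \<subseteq> {A..B} \<and> h = b - a \<and> 0 < h \<and> h \<le> 1 \<and> 1 \<le> n \<and> k \<le> n - 1"
    then have sub: "{a..b} \<subseteq> {A..B}" and h: "h = b - a" by blast+
    from * have ab: "a < b" "b - a \<le> 1" and k: "k < n" by auto
    define e where "e = min (n + 1) (m + 1)"
    have e: "1 \<le> e" "e \<le> Suc m" "e - 1 \<le> n" by (auto simp: e_def)
    have AB: "A \<le> a" "b \<le> B" using sub ab by auto
    have Dab: "(D j has_real_derivative D (Suc j) x) (at x)" if "j \<le> m" "x \<in> {a<..<b} - Z" for j x
      using D[OF that(1), of x] that(2) AB by auto
    have Dcab: "continuous_on {a..b} (D j)" if "j \<le> m" for j
      using Dc[OF that] sub by (rule continuous_on_subset)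
    have Dc': "continuous_on {a..b} (D j)" if "j < Suc m" for j using Dcab that by simp
    have D': "(D j has_real_derivative D (Suc j) x) (at x)"
      if "j < Suc m" "x \<in> {a<..<b} - Z" for j x using Dab that by simp
    have bd': "\<bar>D j x\<bar> \<le> S" if "j \<le> Suc m" "x \<in> {a..b}" for j x
      using bd[OF that(1)] that(2) sub by blast
    obtain p where deg: "degree p \<le> e - 1" and high: "\<And>j. e \<le> j \<Longrightarrow> (pderiv ^^ j) p = 0"
      and rem: "\<And>j x. j \<le> Suc m \<Longrightarrow> x \<in> {a..b} \<Longrightarrow>
           \<bar>D j x - poly ((pderiv ^^ j) p) x\<bar> \<le> S * (b - a) ^ (e - j)"
      using taylor_remainder_bounds[where D = D and N = "Suc m" and S = S, OF Z e(1,2) ab(1) Dc' D' bd'] by blast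
    show "\<bar>cheb_coeff (pullback u a b) k - disc_cheb_coeff n (pullback u a b) k\<bar>
      \<le> 128 * real (m + 3) ^ (m + 2) * S * (h ^ min (n + 1) (m + 1) / real n ^ (m + 2))"
      unfolding h e_def[symmetric]
    proof (rule coefficient_error_le[where r = "\<lambda>j x. D j x - poly ((pderiv ^^ j) p) x" and p = p
          and F = F and G = G and Z = Z])
      show "continuous_on {a..b} (\<lambda>x. D j x - poly ((pderiv ^^ j) p) x)" if "j \<le> m" for j
        by (intro continuous_intros Dcab that)
      show "((\<lambda>x. D j x - poly ((pderiv ^^ j) p) x) has_real_derivative
          D (Suc j) x - poly ((pderiv ^^ Suc j) p) x) (at x)" if "j \<le> m" "x \<in> {a<..<b} - Z" for j x
        using that by (auto intro!: derivative_eq_intros Dab poly_DERIV)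
      show "D (Suc m) x - poly ((pderiv ^^ Suc m) p) x = F x - G x" for x
        unfolding high[OF e(2)] top by simp
      show "mono_on {a..b} F" "mono_on {a..b} G"
        using mono sub by (auto intro: mono_on_subset)
      show "\<bar>F x\<bar> \<le> S * (b - a) ^ (e - Suc m)" "\<bar>G x\<bar> \<le> S * (b - a) ^ (e - Suc m)" if "x \<in> {a..b}" for x
        using bdFG[of x] that sub e by auto
      show "u x = D 0 x - poly ((pderiv ^^ 0) p) x + poly p x" if "x \<in> {a..b}" for x
        using D0[of x] that sub by auto
      show "degree p \<le> n" using deg e by simp
    qed (use ab Z k rem in auto)
  qed (use S in simp)
qed

text \<open>
  One more degree can be removed. The variation of \<open>D (m + 1)\<close> over a subinterval is of order
  \<open>b - a\<close>, as the next derivative is bounded by \<open>S\<close>; adding \<open>S * (x - a)\<close> makes it monotone without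
  destroying this smallness.
\<close>

lemma error_bound_Ck:
  assumes "Ck_on (m + 2) u {A..B}"
  shows "\<exists>C>0. \<forall>a b h :: real. \<forall>n k :: nat.
    {a..b} \<subseteq> {A..B} \<and> h = b - a \<and> 0 < h \<and> h \<le> 1 \<and> 1 \<le> n \<and> k \<le> n - 1 \<longrightarrow>
    \<bar>cheb_coeff (pullback u a b) k - disc_cheb_coeff n (pullback u a b) k\<bar>
      \<le> C * (h ^ min (n + 1) (m + 2) / real n ^ (m + 2))"
proof -
  obtain D where D0: "\<And>x. x \<in> {A..B} \<Longrightarrow> D 0 x = u x"
    and Dc: "\<And>j. j \<le> m + 2 \<Longrightarrow> continuous_on {A..B} (D j)"
    and D: "\<And>j x. j < m + 2 \<Longrightarrow> x \<in> {A<..<B} \<Longrightarrow> (D j has_real_derivative D (Suc j) x) (at x)"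
    using Ck_on_derivatives[OF assms] by blast
  obtain S where S: "0 < S" and bd: "\<And>j x. j \<le> m + 2 \<Longrightarrow> x \<in> {A..B} \<Longrightarrow> \<bar>D j x\<bar> \<le> S"
    using continuous_family_bounded[of "m + 2" A B D] Dc by blast
  show ?thesis
  proof (intro exI[of _ "128 * real (m + 3) ^ (m + 2) * (2 * S)"] conjI allI impI)
    fix a b h :: real and n k :: nat
    assume *: "{a..b} \<subseteq> {A..B} \<and> h = b - a \<and> 0 < h \<and> h \<le> 1 \<and> 1 \<le> n \<and> k \<le> n - 1"
    then have sub: "{a..b} \<subseteq> {A..B}" and h: "h = b - a" by blast+
    from * have ab: "a < b" "b - a \<le> 1" and k: "k < n" by auto
    define e where "e = min (n + 1) (m + 2)"
    have e: "1 \<le> e" "e \<le> m + 2" "e - 1 \<le> n" by (auto simp: e_def)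
    have AB: "A \<le> a" "b \<le> B" using sub ab by auto
    have Dab: "(D j has_real_derivative D (Suc j) x) (at x)" if "j < m + 2" "x \<in> {a<..<b}" for j x
      using D[OF that(1), of x] that(2) AB by auto
    have Dcab: "continuous_on {a..b} (D j)" if "j \<le> m + 2" for j
      using Dc[OF that] sub by (rule continuous_on_subset)
    have bdab: "\<bar>D j x\<bar> \<le> S" if "j \<le> m + 2" "x \<in> {a..b}" for j x
      using bd[OF that(1)] that(2) sub by blast
    have Dc': "continuous_on {a..b} (D j)" if "j < m + 2" for j using Dcab that by simp
    have D': "(D j has_real_derivative D (Suc j) x) (at x)"
      if "j < m + 2" "x \<in> {a<..<b} - {}" for j x using Dab that by simp
    obtain p where deg: "degree p \<le> e - 1" and high: "\<And>j. e \<le> j \<Longrightarrow> (pderiv ^^ j) p = 0"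
      and rem: "\<And>j x. j \<le> m + 2 \<Longrightarrow> x \<in> {a..b} \<Longrightarrow>
           \<bar>D j x - poly ((pderiv ^^ j) p) x\<bar> \<le> S * (b - a) ^ (e - j)"
      using taylor_remainder_bounds[where D = D and Z = "{}" and N = "m + 2" and S = S, OF finite.emptyI e(1,2) ab(1) Dc' D' bdab] by blast
    define r where "r = (\<lambda>j x. D j x - poly ((pderiv ^^ j) p) x)"
    have r_der: "(r j has_real_derivative r (Suc j) x) (at x)" if "j < m + 2" "x \<in> {a<..<b}" for j x
      unfolding r_def using that by (auto intro!: derivative_eq_intros Dab poly_DERIV)
    have r_cont: "continuous_on {a..b} (r j)" if "j \<le> m + 2" for j
      unfolding r_def by (intro continuous_intros Dcab that)
    have r_lip: "\<bar>r (Suc m) y - r (Suc m) x\<bar> \<le> S * (y - x)" if "a \<le> x" "x \<le> y" "y \<le> b" for x y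
    proof (rule increment_le[of "{}" x y _ "r (m + 2)"])
      show "continuous_on {x..y} (r (Suc m))"
        using r_cont[of "Suc m"] that by (auto intro: continuous_on_subset)
      show "\<bar>r (m + 2) t\<bar> \<le> S" if "t \<in> {x..y}" for t
        using bdab[of "m + 2" t] that \<open>a \<le> x\<close> \<open>y \<le> b\<close> high[OF e(2)] by (simp add: r_def)
      show "(r (Suc m) has_real_derivative r (m + 2) t) (at t)" if "t \<in> {x<..<y} - {}" for t
        using r_der[of "Suc m" t] that \<open>a \<le> x\<close> \<open>y \<le> b\<close> by auto
    qed (use that in auto)
    \<comment> \<open>The exponent is at most one, since \<open>e \<le> m + 2\<close>.\<close>
    have le_h: "b - a \<le> (b - a) ^ (e - Suc m)"
      using power_decreasing[of "e - Suc m" 1 "b - a"] e ab by simp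
    have lin: "\<bar>S * (x - a)\<bar> \<le> S * (b - a) ^ (e - Suc m)" if "x \<in> {a..b}" for x
    proof -
      have "x - a \<le> (b - a) ^ (e - Suc m)" using le_h that by simp
      then show ?thesis using S that by (auto simp: abs_mult intro!: mult_left_mono)
    qed
    have pos: "0 \<le> S * (b - a) ^ j" for j using S ab by simp
    show "\<bar>cheb_coeff (pullback u a b) k - disc_cheb_coeff n (pullback u a b) k\<bar>
      \<le> 128 * real (m + 3) ^ (m + 2) * (2 * S) * (h ^ min (n + 1) (m + 2) / real n ^ (m + 2))"
      unfolding h e_def[symmetric]
    proof (rule coefficient_error_le[where r = r and p = p
          and F = "\<lambda>x. r (Suc m) x + S * (x - a)" and G = "\<lambda>x. S * (x - a)" and Z = "{}"])
      show "mono_on {a..b} (\<lambda>x. r (Suc m) x + S * (x - a))"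
      proof (rule mono_onI)
        fix x y assume "x \<in> {a..b}" "y \<in> {a..b}" "x \<le> y"
        then have "r (Suc m) x - r (Suc m) y \<le> S * (y - x)" using r_lip[of x y] by auto
        then show "r (Suc m) x + S * (x - a) \<le> r (Suc m) y + S * (y - a)"
          by (simp add: algebra_simps)
      qed
      show "mono_on {a..b} (\<lambda>x. S * (x - a))"
        using S by (intro mono_onI mult_left_mono) auto
      show "\<bar>r j x\<bar> \<le> 2 * S * (b - a) ^ (e - j)" if "j \<le> Suc m" "x \<in> {a..b}" for j x
        using rem[of j x] that pos[of "e - j"] by (simp add: r_def)
      show "\<bar>r (Suc m) x + S * (x - a)\<bar> \<le> 2 * S * (b - a) ^ (e - Suc m)" if "x \<in> {a..b}" for x
        using rem[of "Suc m" x] lin[OF that] that by (simp add: r_def)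
      show "\<bar>S * (x - a)\<bar> \<le> 2 * S * (b - a) ^ (e - Suc m)" if "x \<in> {a..b}" for x
        using lin[OF that] pos[of "e - Suc m"] by simp
      show "u x = r 0 x + poly p x" if "x \<in> {a..b}" for x
        using D0[of x] that sub by (auto simp: r_def)
      show "degree p \<le> n" using deg e by simp
    qed (use ab k r_der r_cont in auto)
  qed (use S in simp)
qed

theorem theorem3p6:
  fixes m :: nat and A B :: real and u :: "real \<Rightarrow> real"
  assumes "A \<le> B"
  shows
    "(u \<in> X_space m {A..B} \<longrightarrow>
       (\<exists>C>0. \<forall>a b h :: real. \<forall>n k :: nat.
          {a..b} \<subseteq> {A..B} \<and> h = b - a \<and> 0 < h \<and> h \<le> 1 \<and> 1 \<le> n \<and> k \<le> n - 1 \<longrightarrow>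
          \<bar>cheb_coeff (pullback u a b) k - disc_cheb_coeff n (pullback u a b) k\<bar>
            \<le> C * (h ^ min (n + 1) (m + 1) / real n ^ (m + 2))))
     \<and>
     (Ck_on (m + 2) u {A..B} \<longrightarrow>
       (\<exists>C>0. \<forall>a b h :: real. \<forall>n k :: nat.
          {a..b} \<subseteq> {A..B} \<and> h = b - a \<and> 0 < h \<and> h \<le> 1 \<and> 1 \<le> n \<and> k \<le> n - 1 \<longrightarrow>
          \<bar>cheb_coeff (pullback u a b) k - disc_cheb_coeff n (pullback u a b) k\<bar>
            \<le> C * (h ^ min (n + 1) (m + 2) / real n ^ (m + 2))))"
  using error_bound_X_space error_bound_Ck by blast

end
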